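(* Let $\mathcal P$ be a finite set of points in $\mathbb R^2$ with the Euclidean metric, and let $G=(\mathcal P,E)$ be an undirected network in which every agent is greedy connected and whose number of edges is minimum among all such networks on $\mathcal P$ (a social optimum network). Then there is an assignment of each edge of $E$ to exactly one of its endpoints as owner such that the resulting strategy profile of the undirected greedy routing network creation game is a $2$-additive Nash equilibrium.
   Context: Undirected variant of the game: $\mathcal P$ is a finite set of points (agents) with metric $d$; each agent $u$ chooses a strategy $S_u\subseteq\{\{u,v\}:v\in\mathcal P\setminus\{u\}\}$ of undirected edges, which it owns; a profile $\mathbf s$ induces the network $G(\mathbf s)$ on $\mathcal P$ in which $\{u,v\}$ is an edge iff $\{u,v\}\in S_u\cup S_v$. A greedy routing path from $u$ to $w$ is a path $(x_1=u,\dots,x_j=w)$ in the network with $d(x_i,w)>d(x_{i+1},w)$ for all $i$; $u$ is greedy connected if it has a greedy routing path to every other agent. The cost of $u$ is $c_u(\mathbf s)=|S_u|$ if $u$ is greedy connected and $\infty$ otherwise. A profile $\mathbf s$ is a $\gamma$-additive Nash equilibrium if no agent $u$ can, by unilaterally changing its strategy, obtain cost strictly less than $c_u(\mathbf s)-\gamma$. *)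

theory Defs
  imports "HOL-Analysis.Analysis" "HOL-Library.Extended_Real"
begin

definition possible_edges :: "'a set \<Rightarrow> 'a \<Rightarrow> 'a set set" where
  "possible_edges P u = {{u, v} | v. v \<in> P - {u}}"

definition edge_set_on :: "'a set \<Rightarrow> 'a set set \<Rightarrow> bool" where
  "edge_set_on P E \<longleftrightarrow> (\<forall>e\<in>E. \<exists>u v. u \<in> P \<and> v \<in> P \<and> u \<noteq> v \<and> e = {u, v})"

definition valid_profile :: "'a set \<Rightarrow> ('a \<Rightarrow> 'a set set) \<Rightarrow> bool" where
  "valid_profile P s \<longleftrightarrow> (\<forall>u\<in>P. s u \<subseteq> possible_edges P u)"

definition network :: "'a set \<Rightarrow> ('a \<Rightarrow> 'a set set) \<Rightarrow> 'a set set" where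
  "network P s = (\<Union>u\<in>P. s u)"

definition greedy_path :: "'a set set \<Rightarrow> ('a::metric_space) list \<Rightarrow> 'a \<Rightarrow> 'a \<Rightarrow> bool" where
  "greedy_path E xs u w \<longleftrightarrow> xs \<noteq> [] \<and> hd xs = u \<and> last xs = w \<and>
     (\<forall>i. Suc i < length xs \<longrightarrow> {xs ! i, xs ! Suc i} \<in> E \<and>
                               dist (xs ! i) w > dist (xs ! Suc i) w)"

definition greedy_connected :: "'a set \<Rightarrow> 'a set set \<Rightarrow> ('a::metric_space) \<Rightarrow> bool" where
  "greedy_connected P E u \<longleftrightarrow> (\<forall>w\<in>P - {u}. \<exists>xs. greedy_path E xs u w)"

definition cost :: "'a set \<Rightarrow> ('a \<Rightarrow> 'a set set) \<Rightarrow> ('a::metric_space) \<Rightarrow> ereal" where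
  "cost P s u = (if greedy_connected P (network P s) u then ereal (real (card (s u))) else \<infinity>)"

definition additive_NE :: "('a::metric_space) set \<Rightarrow> ('a \<Rightarrow> 'a set set) \<Rightarrow> real \<Rightarrow> bool" where
  "additive_NE P s \<gamma> \<longleftrightarrow> valid_profile P s \<and>
     (\<forall>u\<in>P. \<forall>S. S \<subseteq> possible_edges P u \<longrightarrow>
        \<not> (cost P (s(u := S)) u < cost P s u - ereal \<gamma>))"

definition social_optimum :: "('a::metric_space) set \<Rightarrow> 'a set set \<Rightarrow> bool" where
  "social_optimum P E \<longleftrightarrow> edge_set_on P E \<and> (\<forall>u\<in>P. greedy_connected P E u) \<and>
     (\<forall>E'. edge_set_on P E' \<and> (\<forall>u\<in>P. greedy_connected P E' u) \<longrightarrow> card E \<le> card E')"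

end

theory Submission
  imports Defs
begin

text \<open>
  For a set \<open>D\<close> of edges at \<open>u\<close>, let \<open>br u D\<close> be the least number of edges that \<open>u\<close> has to add so that
  it can make every greedy step after \<open>D\<close> has been deleted. If \<open>u\<close> owns \<open>S\<close>, its best deviation costs at
  least \<open>br u S\<close>, so it suffices to distribute the edges in such a way that everybody owns at most
  \<open>br u S + 2\<close> edges. Optimality enters twice. Deleting any \<open>D \<subseteq> E\<close> and letting every vertex repair
  its own loss shows \<open>|D| \<le> (\<Sum>u. br u (D\<^sub>u))\<close>, where \<open>D\<^sub>u\<close> are the edges of \<open>D\<close> at \<open>u\<close>. Replacing the edges
  inside a vertex set \<open>V\<close> by the Delaunay graph of \<open>V\<close>, which preserves all greedy steps within \<open>V\<close>,
  shows \<open>|E[V]| < 3 |V|\<close>. Hence \<open>E\<close> splits into a forest and a graph with an orientation of outdegree at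
  most 2. In the forest, whose branches are disjoint, the first inequality is exactly what is needed
  to hand every edge to an endpoint so that the received edges \<open>F\<close> satisfy \<open>|F| \<le> br u F\<close>.
\<close>

section \<open>Voronoi diagrams in the plane have fewer than \<open>3n\<close> edges\<close>

lemma eventually_affine_less:
  fixes a b c d :: real
  assumes "a < b"
  shows "eventually (\<lambda>e. a + e * c < b + e * d) (at_right 0)"
proof -
  have "((\<lambda>e. (b + e * d) - (a + e * c)) \<longlongrightarrow> (b + 0 * d) - (a + 0 * c)) (at_right 0)"
    by (intro tendsto_intros)
  then have "eventually (\<lambda>e. 0 < (b + e * d) - (a + e * c)) (at_right 0)"
    using assms by (intro order_tendstoD(1)) auto
  then show ?thesis by (rule eventually_mono) simp
qed

lemma convex_combination_less:
  fixes x y x' y' :: real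
  assumes "x < y" "x' < y'" "0 \<le> a" "0 \<le> b" "a + b = 1"
  shows "a * x + b * x' < a * y + b * y'"
proof (cases "a = 0")
  case False
  then have "a * x < a * y" using assms by simp
  moreover have "b * x' \<le> b * y'" using assms by (simp add: mult_left_mono)
  ultimately show ?thesis by simp
qed (use assms in simp)

lemma convex_real_between:
  fixes S :: "real set"
  assumes "convex S" "a \<in> S" "b \<in> S" "a \<le> t" "t \<le> b"
  shows "t \<in> S"
  using assms(1) by (intro mem_is_interval_1_I[OF _ assms(2-5)]) (simp add: is_interval_convex_1)

text \<open>An element of \<open>S\<close> below some \<open>t\<close> in \<open>T\<close> has in
  turn an element of \<open>T\<close> below it, so convexity of \<open>T\<close> traps it. This is
  how two adjacencies charged to the same event are shown to coexist at some height.\<close>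

lemma coinitial_meet:
  fixes S T :: "real set"
  assumes "convex S" "convex T" "S \<noteq> {}" "T \<noteq> {}"
    and "\<And>t. t \<in> T \<Longrightarrow> \<exists>s\<in>S. s \<le> t" "\<And>s. s \<in> S \<Longrightarrow> \<exists>t\<in>T. t \<le> s"
  shows "S \<inter> T \<noteq> {}"
proof -
  obtain t where t: "t \<in> T" using assms(4) by auto
  obtain s where s: "s \<in> S" "s \<le> t" using assms(5)[OF t] by auto
  obtain t' where t': "t' \<in> T" "t' \<le> s" using assms(6)[OF s(1)] by auto
  have "s \<in> T" using convex_real_between[OF assms(2) t'(1) t t'(2) s(2)] .
  then show ?thesis using s(1) by auto
qed

locale affine_sweep =
  fixes V :: "'a set" and \<alpha> \<beta> \<gamma> :: "'a \<Rightarrow> real"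
  assumes finV: "finite V" and inj: "inj_on \<alpha> V"
begin

definition h :: "'a \<Rightarrow> real \<Rightarrow> real \<Rightarrow> real" where
  "h v s t = \<gamma> v - \<alpha> v * s - \<beta> v * t"

text \<open>
  After subtracting a term that does not depend on the site, squared distances to the sites are affine functions
  \<open>h\<close> of the position \<open>(s, t)\<close>. On the horizontal line at height \<open>t\<close>, \<open>live\<close> sites own a piece of the
  line, and two sites are \<open>active\<close> if their pieces are adjacent. As \<open>t\<close> grows, a new adjacency \<open>u v\<close>
  can only arise because \<open>u\<close> or \<open>v\<close> is born or because a site between them dies. This charges every
  edge to a birth (from the left or from the right) or to a death, and each event is charged only once.
\<close>

definition live :: "'a \<Rightarrow> real set" where
  "live v = {t. \<exists>s. \<forall>x\<in>V - {v}. h v s t < h x s t}"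

definition active :: "'a \<Rightarrow> 'a \<Rightarrow> real set" where
  "active u v = {t. \<exists>s. h u s t = h v s t \<and> (\<forall>x\<in>V - {u, v}. h u s t < h x s t)}"

text \<open>In \<open>s\<close> the functions have slope \<open>- \<alpha>\<close>, so moving right
  favours larger \<open>\<alpha>\<close>: on every horizontal line the pieces are ordered by
  \<open>\<alpha>\<close>.\<close>

lemma minimizer_mono:
  assumes "h x s t \<le> h y s t" "h y s' t \<le> h x s' t" "s < s'"
  shows "\<alpha> x \<le> \<alpha> y"
proof (rule ccontr)
  assume "\<not> \<alpha> x \<le> \<alpha> y"
  then have "(\<alpha> x - \<alpha> y) * (s' - s) > 0" using assms(3) by simp
  then show False using assms(1,2) unfolding h_def by (simp add: algebra_simps)
qed

lemma minimizer_strict_mono: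
  assumes "h x s t < h y s t" "h y s' t < h x s' t" "\<alpha> x \<le> \<alpha> y"
  shows "s < s' \<and> \<alpha> x < \<alpha> y"
proof -
  have "(\<alpha> y - \<alpha> x) * (s' - s) > 0"
    using assms(1,2) unfolding h_def by (simp add: algebra_simps)
  with assms(3) show ?thesis by (simp add: zero_less_mult_iff)
qed

text \<open>By monotonicity of minimizers, the lower envelope at height \<open>t\<close> has only
  one breakpoint at which \<open>\<alpha>\<close> jumps over the threshold \<open>a\<close>, and a
  breakpoint witnessing \<open>active\<close> has exactly two minimizers.\<close>

lemma active_unique:
  assumes V: "u \<in> V" "v \<in> V" "u' \<in> V" "v' \<in> V"
    and t: "t \<in> active u v" "t \<in> active u' v'"
    and a: "\<alpha> u \<le> a" "a < \<alpha> v" "\<alpha> u' \<le> a" "a < \<alpha> v'"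
  shows "u = u' \<and> v = v'"
proof -
  obtain s where s: "h u s t = h v s t" "\<forall>x\<in>V - {u, v}. h u s t < h x s t"
    using t(1) unfolding active_def by auto
  obtain s' where s': "h u' s' t = h v' s' t" "\<forall>x\<in>V - {u', v'}. h u' s' t < h x s' t"
    using t(2) unfolding active_def by auto
  have le: "h u s t \<le> h x s t" if "x \<in> V" for x
    using s that by (cases "x \<in> {u, v}") (auto intro: less_imp_le)
  have le': "h u' s' t \<le> h x s' t" if "x \<in> V" for x
    using s' that by (cases "x \<in> {u', v'}") (auto intro: less_imp_le)
  have "\<not> s < s'"
    using minimizer_mono[of v s t u' s'] le[of u'] le'[of v] s(1) V a by auto
  moreover have "\<not> s' < s"
    using minimizer_mono[of v' s' t u s] le[of v'] le'[of u] s'(1) V a by auto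
  ultimately have "s = s'" by simp
  have "x \<in> {u, v}" if "x \<in> V" "h x s t = h u' s t" for x
  proof (rule ccontr)
    assume "x \<notin> {u, v}"
    then have "h u s t < h x s t" using s(2) that(1) by blast
    then show False using that(2) le'[OF V(1)] \<open>s = s'\<close> by simp
  qed
  then have "u' \<in> {u, v}" "v' \<in> {u, v}" using V(3,4) s'(1) \<open>s = s'\<close> by auto
  with a show ?thesis by auto
qed

text \<open>A small step to the right breaks ties in favour of the largest \<open>\<alpha>\<close>
  and preserves the finitely many strict inequalities.\<close>

lemma live_right:
  assumes "w \<in> V" and "\<And>x. x \<in> V - {w} \<Longrightarrow> h w s t < h x s t \<or> h w s t = h x s t \<and> \<alpha> x < \<alpha> w"
  shows "t \<in> live w"
proof -
  have "eventually (\<lambda>e. h w (s + e) t < h x (s + e) t) (at_right 0)" if x: "x \<in> V - {w}" for x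
    using assms(2)[OF x]
  proof
    assume "h w s t < h x s t"
    from eventually_affine_less[OF this, of "- \<alpha> w" "- \<alpha> x"]
    show ?thesis by (rule eventually_mono) (simp add: h_def algebra_simps)
  next
    assume *: "h w s t = h x s t \<and> \<alpha> x < \<alpha> w"
    have "eventually (\<lambda>e::real. 0 < e) (at_right 0)" by (simp add: eventually_at_right_less)
    then show ?thesis
    proof (rule eventually_mono)
      fix e :: real assume "0 < e"
      then have "\<alpha> x * e < \<alpha> w * e" using * by simp
      then show "h w (s + e) t < h x (s + e) t"
        using * unfolding h_def by (simp add: algebra_simps)
    qed
  qed
  then have "eventually (\<lambda>e. \<forall>x\<in>V - {w}. h w (s + e) t < h x (s + e) t) (at_right 0)"
    using finV by (intro eventually_ball_finite) auto
  then obtain e where "\<forall>x\<in>V - {w}. h w (s + e) t < h x (s + e) t"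
    using eventually_happens'[OF trivial_limit_at_right_real] by blast
  then show ?thesis unfolding live_def by blast
qed

lemma live_left:
  assumes "w \<in> V" and "\<And>x. x \<in> V - {w} \<Longrightarrow> h w s t < h x s t \<or> h w s t = h x s t \<and> \<alpha> w < \<alpha> x"
  shows "t \<in> live w"
proof -
  interpret mirror: affine_sweep V "\<lambda>v. - \<alpha> v" \<beta> \<gamma>
    using finV inj by unfold_locales (auto simp: inj_on_def)
  have eq: "mirror.h v (- r) t = h v r t" for v r t unfolding h_def mirror.h_def by simp
  have "t \<in> mirror.live w"
    by (rule mirror.live_right[of w "- s"]) (use assms in \<open>auto simp: eq\<close>)
  then obtain r where "\<forall>x\<in>V - {w}. mirror.h w (- (- r)) t < mirror.h x (- (- r)) t"
    unfolding mirror.live_def by auto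
  then show ?thesis unfolding live_def eq by blast
qed

lemma active_live:
  assumes "u \<in> V" "v \<in> V" "\<alpha> u < \<alpha> v"
  shows "active u v \<subseteq> live u" "active u v \<subseteq> live v"
proof -
  show "active u v \<subseteq> live u"
  proof
    fix t assume "t \<in> active u v"
    then obtain s where s: "h u s t = h v s t" "\<forall>x\<in>V - {u, v}. h u s t < h x s t"
      unfolding active_def by auto
    show "t \<in> live u" by (rule live_left[of u s]) (use s assms in auto)
  qed
  show "active u v \<subseteq> live v"
  proof
    fix t assume "t \<in> active u v"
    then obtain s where s: "h u s t = h v s t" "\<forall>x\<in>V - {u, v}. h u s t < h x s t"
      unfolding active_def by auto
    show "t \<in> live v" by (rule live_right[of v s]) (use s assms in auto)
  qed
qed

section \<open>Cells and their borders projected to the height: convex and without least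
  element\<close>

lemma h_convex:
  assumes "a + b = 1"
  shows "h v (a * s + b * s') (a * t + b * t') = a * h v s t + b * h v s' t'"
proof -
  have "\<gamma> v = a * \<gamma> v + b * \<gamma> v" using assms by (metis distrib_right mult_1)
  then show ?thesis unfolding h_def by (simp add: algebra_simps)
qed

text \<open>\<open>live v\<close> is the projection to the \<open>t\<close>-axis of the open cell of
  \<open>v\<close>, which is convex because \<open>h\<close> is affine in the position.\<close>

lemma convex_live: "convex (live v)"
proof (rule convexI)
  fix t t' a b :: real
  assume "t \<in> live v" "t' \<in> live v" and ab: "0 \<le> a" "0 \<le> b" "a + b = 1"
  then obtain s s' where "\<forall>x\<in>V - {v}. h v s t < h x s t" "\<forall>x\<in>V - {v}. h v s' t' < h x s' t'"
    unfolding live_def by auto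
  then have "\<forall>x\<in>V - {v}. h v (a * s + b * s') (a * t + b * t') < h x (a * s + b * s') (a * t + b * t')"
    using ab by (simp add: h_convex convex_combination_less)
  then show "a *\<^sub>R t + b *\<^sub>R t' \<in> live v" unfolding live_def by auto
qed

lemma convex_active: "convex (active u v)"
proof (rule convexI)
  fix t t' a b :: real
  assume "t \<in> active u v" "t' \<in> active u v" and ab: "0 \<le> a" "0 \<le> b" "a + b = 1"
  then obtain s s' where "h u s t = h v s t" "\<forall>x\<in>V - {u, v}. h u s t < h x s t"
     "h u s' t' = h v s' t'" "\<forall>x\<in>V - {u, v}. h u s' t' < h x s' t'"
    unfolding active_def by auto
  then have "h u (a * s + b * s') (a * t + b * t') = h v (a * s + b * s') (a * t + b * t') \<and>
    (\<forall>x\<in>V - {u, v}. h u (a * s + b * s') (a * t + b * t') < h x (a * s + b * s') (a * t + b * t'))"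
    using ab by (simp add: h_convex convex_combination_less)
  then show "a *\<^sub>R t + b *\<^sub>R t' \<in> active u v" unfolding active_def by auto
qed

lemma live_extends_down:
  assumes "t \<in> live v"
  shows "\<exists>t'<t. t' \<in> live v"
proof -
  obtain s where s: "\<forall>x\<in>V - {v}. h v s t < h x s t" using assms unfolding live_def by auto
  have "eventually (\<lambda>e. h v s (t - e) < h x s (t - e)) (at_right 0)" if "x \<in> V - {v}" for x
    using eventually_affine_less[of "h v s t" "h x s t" "\<beta> v" "\<beta> x"] s that
    by (auto elim!: eventually_mono simp: h_def algebra_simps)
  then have "eventually (\<lambda>e. \<forall>x\<in>V - {v}. h v s (t - e) < h x s (t - e)) (at_right 0)"
    using finV by (intro eventually_ball_finite) auto
  moreover have "eventually (\<lambda>e::real. 0 < e) (at_right 0)" by (simp add: eventually_at_right_less)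
  ultimately have "eventually (\<lambda>e. 0 < e \<and> (\<forall>x\<in>V - {v}. h v s (t - e) < h x s (t - e))) (at_right 0)"
    by (simp add: eventually_conj_iff)
  then obtain e where "0 < e" "\<forall>x\<in>V - {v}. h v s (t - e) < h x s (t - e)"
    using eventually_happens'[OF trivial_limit_at_right_real] by blast
  then show ?thesis unfolding live_def by (intro exI[of _ "t - e"]) auto
qed

lemma active_extends_down:
  assumes "t \<in> active u v" "\<alpha> u \<noteq> \<alpha> v"
  shows "\<exists>t'<t. t' \<in> active u v"
proof -
  obtain s where s: "h u s t = h v s t" "\<forall>x\<in>V - {u, v}. h u s t < h x s t"
    using assms unfolding active_def by auto
  \<comment> \<open>\<open>(r, -1)\<close> is the downward direction of the bisector of
    \<open>u\<close> and \<open>v\<close>, along which the tie persists.\<close>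
  define r where "r = (\<beta> u - \<beta> v) / (\<alpha> u - \<alpha> v)"
  have r: "\<alpha> u * r - \<beta> u = \<alpha> v * r - \<beta> v"
    using assms(2) unfolding r_def by (simp add: field_simps)
  have tie: "h u (s + e * r) (t - e) = h v (s + e * r) (t - e)" for e
  proof -
    have "h w (s + e * r) (t - e) = h w s t - e * (\<alpha> w * r - \<beta> w)" for w
      unfolding h_def by (simp add: algebra_simps)
    then show ?thesis using s(1) r by simp
  qed
  have "eventually (\<lambda>e. h u (s + e * r) (t - e) < h x (s + e * r) (t - e)) (at_right 0)"
    if "x \<in> V - {u, v}" for x
    using eventually_affine_less[of "h u s t" "h x s t" "\<beta> u - \<alpha> u * r" "\<beta> x - \<alpha> x * r"] s(2) that
    by (auto elim!: eventually_mono simp: h_def algebra_simps)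
  then have "eventually (\<lambda>e. \<forall>x\<in>V - {u, v}. h u (s + e * r) (t - e) < h x (s + e * r) (t - e)) (at_right 0)"
    using finV by (intro eventually_ball_finite) auto
  moreover have "eventually (\<lambda>e::real. 0 < e) (at_right 0)" by (simp add: eventually_at_right_less)
  ultimately have "eventually (\<lambda>e. 0 < e \<and>
      (\<forall>x\<in>V - {u, v}. h u (s + e * r) (t - e) < h x (s + e * r) (t - e))) (at_right 0)"
    by (simp add: eventually_conj_iff)
  then obtain e where "0 < e" "\<forall>x\<in>V - {u, v}. h u (s + e * r) (t - e) < h x (s + e * r) (t - e)"
    using eventually_happens'[OF trivial_limit_at_right_real] by blast
  then have "t - e \<in> active u v" using tie unfolding active_def by blast
  then show ?thesis using \<open>0 < e\<close> by (intro exI[of _ "t - e"]) auto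
qed

text \<open>The piece of a live \<open>w\<close> would have to lie both to the right and to the left
  of the breakpoint between \<open>u\<close> and \<open>v\<close>.\<close>

lemma dead_while_active:
  assumes "u \<in> V" "v \<in> V" "w \<in> V" "\<alpha> u < \<alpha> w" "\<alpha> w < \<alpha> v" "t \<in> active u v"
  shows "t \<notin> live w"
proof
  assume "t \<in> live w"
  then obtain r where r: "\<forall>x\<in>V - {w}. h w r t < h x r t" unfolding live_def by auto
  obtain s where s: "h u s t = h v s t" "\<forall>x\<in>V - {u, v}. h u s t < h x s t"
    using assms unfolding active_def by auto
  have "h w r t < h u r t" "h w r t < h v r t" "h u s t < h w s t" "h v s t < h w s t"
    using r s assms by auto
  then have "s < r" "r < s"
    using minimizer_strict_mono[of u s t w r] minimizer_strict_mono[of w r t v s] assms by auto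
  then show False by simp
qed

text \<open>The pieces of \<open>u\<close> and \<open>v\<close> lie on opposite sides of
  \<open>s\<close>. Since \<open>x\<close> is lower at \<open>s\<close>, the envelope passes through
  other sites there, and the order of the pieces confines them between \<open>u\<close> and
  \<open>v\<close>.\<close>

lemma gap_live:
  assumes V: "u \<in> V" "v \<in> V" and lt: "\<alpha> u < \<alpha> v"
    and t: "t \<in> live u" "t \<in> live v"
    and tie: "h u s t = h v s t" and x: "x \<in> V" "h x s t < h u s t"
  shows "\<exists>w\<in>V. \<alpha> u < \<alpha> w \<and> \<alpha> w < \<alpha> v \<and> t \<in> live w"
proof -
  obtain s1 where s1: "\<forall>x\<in>V - {u}. h u s1 t < h x s1 t" using t(1) unfolding live_def by auto
  obtain s2 where s2: "\<forall>x\<in>V - {v}. h v s2 t < h x s2 t" using t(2) unfolding live_def by auto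
  have neq: "u \<noteq> v" using lt by auto
  have uv: "h u s1 t < h v s1 t" "h v s2 t < h u s2 t" using s1 s2 V neq by auto
  have s1s: "s1 < s"
  proof (rule ccontr)
    assume "\<not> s1 < s"
    then have "(\<alpha> v - \<alpha> u) * (s1 - s) \<ge> 0" using lt by simp
    then show False using uv(1) tie unfolding h_def by (simp add: algebra_simps)
  qed
  have ss2: "s < s2"
  proof (rule ccontr)
    assume "\<not> s < s2"
    then have "(\<alpha> v - \<alpha> u) * (s - s2) \<ge> 0" using lt by simp
    then show False using uv(2) tie unfolding h_def by (simp add: algebra_simps)
  qed
  \<comment> \<open>Minimizers at \<open>(s, t)\<close>; the one of largest \<open>\<alpha>\<close>
    wins immediately to the right of \<open>s\<close>, which makes it live.\<close>
  define M where "M = {y \<in> V. \<forall>z\<in>V. h y s t \<le> h z s t}"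
  have "M \<noteq> {}"
  proof -
    have "\<exists>y\<in>V. \<forall>z\<in>V. h y s t \<le> h z s t"
      using finV x(1) by (intro bexI[of _ "arg_min_on (\<lambda>y. h y s t) V"] ballI arg_min_least arg_min_if_finite(1)) auto
    then show ?thesis unfolding M_def by auto
  qed
  moreover have "finite M" using finV unfolding M_def by simp
  ultimately have "Max (\<alpha> ` M) \<in> \<alpha> ` M" by simp
  then obtain w where w: "w \<in> M" "\<alpha> w = Max (\<alpha> ` M)" by auto
  have wmax: "\<alpha> y \<le> \<alpha> w" if "y \<in> M" for y using that w(2) \<open>finite M\<close> by simp
  have wV: "w \<in> V" and wmin: "\<And>z. z \<in> V \<Longrightarrow> h w s t \<le> h z s t" using w(1) unfolding M_def by auto
  have less: "h w s t < h u s t" "h w s t < h v s t" using wmin[OF x(1)] x(2) tie by auto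
  then have wne: "w \<noteq> u" "w \<noteq> v" by auto
  have "\<alpha> u \<le> \<alpha> w"
    using minimizer_mono[of u s1 t w s] s1 wV wne(1) less(1) s1s by (simp add: less_imp_le)
  moreover have "\<alpha> w \<le> \<alpha> v"
    using minimizer_mono[of w s t v s2] s2 wV wne(2) less(2) ss2 by (simp add: less_imp_le)
  moreover have "\<alpha> u \<noteq> \<alpha> w" "\<alpha> w \<noteq> \<alpha> v" using inj wV V wne by (auto dest: inj_onD)
  moreover have "t \<in> live w"
  proof (rule live_right[of w s])
    fix z assume z: "z \<in> V - {w}"
    show "h w s t < h z s t \<or> h w s t = h z s t \<and> \<alpha> z < \<alpha> w"
    proof (cases "z \<in> M")
      case True
      then have "h z s t \<le> h w s t" using wV unfolding M_def by auto
      moreover have "\<alpha> z \<noteq> \<alpha> w" using inj z wV by (auto dest: inj_onD)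
      ultimately show ?thesis using wmax[OF True] wmin[of z] z by auto
    next
      case False
      then obtain y where "y \<in> V" "h y s t < h z s t" using z unfolding M_def by (auto simp: not_le)
      then show ?thesis using wmin[of y] by auto
    qed
  qed (rule wV)
  ultimately show ?thesis using wV by (intro bexI[of _ w]) auto
qed

text \<open>Just below the first height of the adjacency both sites are already live but not
  adjacent, so by \<open>gap_live\<close> some site separates them. By
  \<open>dead_while_active\<close> it cannot survive into the adjacency, so its life ends exactly at
  the infimum.\<close>

lemma edge_born_at_death:
  assumes V: "u \<in> V" "v \<in> V" and lt: "\<alpha> u < \<alpha> v" and ne: "active u v \<noteq> {}"
    and p: "p \<in> live u" "\<And>t. t \<in> active u v \<Longrightarrow> p < t"
    and q: "q \<in> live v" "\<And>t. t \<in> active u v \<Longrightarrow> q < t"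
  shows "\<exists>w\<in>V. \<alpha> u < \<alpha> w \<and> \<alpha> w < \<alpha> v \<and> (\<forall>t\<in>active u v. \<forall>r\<in>live w. r < t) \<and>
           (\<forall>y<Inf (active u v). \<exists>r\<in>live w. y < r)"
proof -
  define \<tau> where "\<tau> = Inf (active u v)"
  have bdd: "bdd_below (active u v)" using p(2) by (meson bdd_below.I less_imp_le)
  have tau_le: "\<tau> \<le> t" if "t \<in> active u v" for t
    unfolding \<tau>_def using that bdd by (rule cInf_lower)
  have pq: "p \<le> \<tau>" "q \<le> \<tau>"
    unfolding \<tau>_def by (rule cInf_greatest[OF ne], erule less_imp_le[OF p(2)])
      (rule cInf_greatest[OF ne], erule less_imp_le[OF q(2)])
  obtain t1 where t1: "t1 \<in> active u v" using ne by auto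
  obtain p' q' where p': "p' < p" "p' \<in> live u" and q': "q' < q" "q' \<in> live v"
    using live_extends_down p(1) q(1) by meson
  have core: "\<exists>w\<in>V. \<alpha> u < \<alpha> w \<and> \<alpha> w < \<alpha> v \<and> (\<exists>r\<in>live w. y < r \<and> r < \<tau>)" if "y < \<tau>" for y
  proof -
    define m where "m = max y (max p' q')"
    have m: "m < \<tau>" using that pq p'(1) q'(1) unfolding m_def by auto
    define t where "t = (m + \<tau>) / 2"
    define t' where "t' = (m + t) / 2"
    have ts: "m < t'" "t' < t" "t < \<tau>" using m unfolding t_def t'_def by (simp_all add: field_simps)
    define \<sigma> where "\<sigma> r = ((\<gamma> u - \<gamma> v) - (\<beta> u - \<beta> v) * r) / (\<alpha> u - \<alpha> v)" for r
    have tie: "h u (\<sigma> r) r = h v (\<sigma> r) r" for r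
    proof -
      have "(\<alpha> u - \<alpha> v) * \<sigma> r = (\<gamma> u - \<gamma> v) - (\<beta> u - \<beta> v) * r" using lt unfolding \<sigma>_def by simp
      then show ?thesis unfolding h_def by (simp add: algebra_simps)
    qed
    have sigma_unique: "s = \<sigma> r" if "h u s r = h v s r" for s r
    proof -
      have "(\<alpha> u - \<alpha> v) * s = (\<alpha> u - \<alpha> v) * \<sigma> r"
        using that tie[of r] unfolding h_def by (simp add: algebra_simps)
      then show ?thesis using lt by simp
    qed
    have "t \<notin> active u v" using tau_le ts by force
    then obtain x where x: "x \<in> V - {u, v}" "h x (\<sigma> t) t \<le> h u (\<sigma> t) t"
      using tie unfolding active_def by (auto simp: not_less)
    \<comment> \<open>Excess of \<open>x\<close> over \<open>u\<close> along their common tie line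
      with \<open>v\<close>: affine in the height, at most 0 at \<open>t\<close> and positive at
      \<open>t1\<close>, hence negative at \<open>t' < t\<close>. This turns a possible tie into the
      strict inequality required by \<open>gap_live\<close>.\<close>
    define g where "g r = h x (\<sigma> r) r - h u (\<sigma> r) r" for r
    obtain s1 where "h u s1 t1 = h v s1 t1" "\<forall>x\<in>V - {u, v}. h u s1 t1 < h x s1 t1"
      using t1 unfolding active_def by auto
    then have g1: "g t1 > 0" using x(1) sigma_unique unfolding g_def by auto
    have g0: "g t \<le> 0" using x(2) unfolding g_def by simp
    have t1t: "t < t1" using ts tau_le[OF t1] by simp
    have "\<exists>A B. \<forall>r. g r = A + B * r"
    proof -
      define k where "k = (\<gamma> u - \<gamma> v) / (\<alpha> u - \<alpha> v)"
      define l where "l = (\<beta> u - \<beta> v) / (\<alpha> u - \<alpha> v)"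
      have sigma: "\<sigma> r = k - l * r" for r unfolding \<sigma>_def k_def l_def by (subst diff_divide_distrib) simp
      have "g r = (\<gamma> x - \<gamma> u - (\<alpha> x - \<alpha> u) * k) + ((\<alpha> x - \<alpha> u) * l - (\<beta> x - \<beta> u)) * r" for r
        unfolding g_def h_def sigma by (simp add: algebra_simps)
      then show ?thesis by blast
    qed
    then obtain A B where AB: "\<And>r. g r = A + B * r" by auto
    have "B * (t1 - t) > 0" using g0 g1 unfolding AB by (simp add: algebra_simps)
    then have "B > 0" using t1t by (simp add: zero_less_mult_iff)
    then have "g t' < g t" using ts unfolding AB by simp
    then have "h x (\<sigma> t') t' < h u (\<sigma> t') t'" using g0 unfolding g_def by simp
    moreover have "t' \<in> live u"
      using convex_real_between[OF convex_live, of p' u t1 t'] p' active_live(1)[OF V lt] t1 ts t1t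
      unfolding m_def by auto
    moreover have "t' \<in> live v"
      using convex_real_between[OF convex_live, of q' v t1 t'] q' active_live(2)[OF V lt] t1 ts t1t
      unfolding m_def by auto
    ultimately obtain w where "w \<in> V" "\<alpha> u < \<alpha> w" "\<alpha> w < \<alpha> v" "t' \<in> live w"
      using gap_live[OF V lt _ _ tie] x(1) by blast
    moreover have "y < t'" "t' < \<tau>" using ts unfolding m_def by auto
    ultimately show ?thesis by blast
  qed
  \<comment> \<open>Finitely many candidates serve heights arbitrarily close to
    \<open>\<tau>\<close>, so a single one of them does.\<close>
  have "\<exists>w\<in>V. \<alpha> u < \<alpha> w \<and> \<alpha> w < \<alpha> v \<and> (\<forall>y<\<tau>. \<exists>r\<in>live w. y < r \<and> r < \<tau>)"
  proof (rule ccontr)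
    assume "\<not> ?thesis"
    then have "\<forall>w\<in>V. \<exists>y<\<tau>. \<alpha> u < \<alpha> w \<and> \<alpha> w < \<alpha> v \<longrightarrow> \<not> (\<exists>r\<in>live w. y < r \<and> r < \<tau>)"
      by (metis lt_ex)
    then obtain Y where Y: "\<And>w. w \<in> V \<Longrightarrow> Y w < \<tau>"
      "\<And>w. w \<in> V \<Longrightarrow> \<alpha> u < \<alpha> w \<and> \<alpha> w < \<alpha> v \<longrightarrow> \<not> (\<exists>r\<in>live w. Y w < r \<and> r < \<tau>)"
      by metis
    have "Max (Y ` V) < \<tau>" using finV V(1) Y(1) by (subst Max_less_iff) auto
    from core[OF this] obtain w r where w: "w \<in> V" "\<alpha> u < \<alpha> w" "\<alpha> w < \<alpha> v" "r \<in> live w"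
      "Max (Y ` V) < r" "r < \<tau>" by auto
    moreover have "Y w \<le> Max (Y ` V)" using finV w(1) by simp
    ultimately show False using Y(2)[of w] by force
  qed
  then obtain w where w: "w \<in> V" "\<alpha> u < \<alpha> w" "\<alpha> w < \<alpha> v"
    "\<And>y. y < \<tau> \<Longrightarrow> \<exists>r\<in>live w. y < r \<and> r < \<tau>" by auto
  have "r < t" if "t \<in> active u v" "r \<in> live w" for t r
  proof (rule ccontr)
    assume "\<not> r < t"
    obtain r0 where "r0 \<in> live w" "r0 < \<tau>" using w(4)[of "\<tau> - 1"] by auto
    then have "t \<in> live w"
      using convex_real_between[OF convex_live, of r0 w r t] that tau_le[OF that(1)] \<open>\<not> r < t\<close> by auto
    then show False using dead_while_active[OF V w(1-3) that(1)] by simp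
  qed
  then show ?thesis using w unfolding \<tau>_def by blast
qed

section \<open>Charging the adjacencies to events of the sweep\<close>

definition edges :: "('a \<times> 'a) set" where
  "edges = {(u, v). u \<in> V \<and> v \<in> V \<and> \<alpha> u < \<alpha> v \<and> active u v \<noteq> {}}"

lemma card_edges:
  assumes "V \<noteq> {}"
  shows "finite edges" "card edges < 3 * card V"
proof -
  have "edges \<subseteq> V \<times> V" unfolding edges_def by auto
  then show fin: "finite edges" using finV finite_subset by blast
  \<comment> \<open>Adjacencies in \<open>R\<close> reach as low as the life of their left site and
    are charged to it; \<open>L\<close> does the same with the right site. In \<open>D\<close> both
    sites are older than the adjacency, so a death is charged.\<close>
  define R where "R = {(u, v) \<in> edges. \<forall>t\<in>live u. \<exists>t'\<in>active u v. t' \<le> t}"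
  define L where "L = {(u, v) \<in> edges. \<forall>t\<in>live v. \<exists>t'\<in>active u v. t' \<le> t}"
  define D where "D = edges - R - L"
  have "finite R" "finite L" "finite D"
    using fin unfolding R_def L_def D_def by (auto elim: rev_finite_subset)
  have "inj_on fst R"
  proof (rule inj_onI, clarsimp)
    fix u v v' assume uv: "(u, v) \<in> R" "(u, v') \<in> R"
    then have e: "u \<in> V" "v \<in> V" "v' \<in> V" "\<alpha> u < \<alpha> v" "\<alpha> u < \<alpha> v'"
      "active u v \<noteq> {}" "active u v' \<noteq> {}" unfolding R_def edges_def by auto
    have "active u v \<inter> active u v' \<noteq> {}"
      using uv active_live(1)[OF e(1,2,4)] active_live(1)[OF e(1,3,5)] e(6,7)
      by (intro coinitial_meet convex_active) (auto simp: R_def)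
    then obtain t where "t \<in> active u v" "t \<in> active u v'" by auto
    from active_unique[OF e(1,2,1,3) this, of "\<alpha> u"] e(4,5) show "v = v'" by auto
  qed
  \<comment> \<open>The site of largest \<open>\<alpha>\<close> has no right neighbour; this missing
    charge makes the final inequality strict.\<close>
  moreover have "fst ` R \<subset> V"
  proof -
    have "Max (\<alpha> ` V) \<in> \<alpha> ` V" using assms finV by simp
    then obtain m where m: "m \<in> V" "\<alpha> m = Max (\<alpha> ` V)" by auto
    have "m \<notin> fst ` R"
    proof
      assume "m \<in> fst ` R"
      then obtain v where "v \<in> V" "\<alpha> m < \<alpha> v" unfolding R_def edges_def by auto
      then show False using m finV by (simp add: leD)
    qed
    then show ?thesis using m(1) unfolding R_def edges_def by auto
  qed
  ultimately have cR: "card R < card V" using finV by (metis card_image psubset_card_mono)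
  have "inj_on snd L"
  proof (rule inj_onI, clarsimp)
    fix u u' v assume uv: "(u, v) \<in> L" "(u', v) \<in> L"
    then have e: "u \<in> V" "u' \<in> V" "v \<in> V" "\<alpha> u < \<alpha> v" "\<alpha> u' < \<alpha> v"
      "active u v \<noteq> {}" "active u' v \<noteq> {}" unfolding L_def edges_def by auto
    have "active u v \<inter> active u' v \<noteq> {}"
      using uv active_live(2)[OF e(1,3,4)] active_live(2)[OF e(2,3,5)] e(6,7)
      by (intro coinitial_meet convex_active) (auto simp: L_def)
    then obtain t where "t \<in> active u v" "t \<in> active u' v" by auto
    from active_unique[OF e(1,3,2,3) this, of "max (\<alpha> u) (\<alpha> u')"] e(4,5) show "u = u'" by auto
  qed
  moreover have "snd ` L \<subseteq> V" unfolding L_def edges_def by auto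
  ultimately have cL: "card L \<le> card V" using finV by (metis card_image card_mono)
  have "\<exists>w. w \<in> V \<and> \<alpha> (fst e) < \<alpha> w \<and> \<alpha> w < \<alpha> (snd e) \<and>
      (\<forall>t\<in>active (fst e) (snd e). \<forall>r\<in>live w. r < t) \<and>
      (\<forall>y<Inf (active (fst e) (snd e)). \<exists>r\<in>live w. y < r)" if eD: "e \<in> D" for e
  proof -
    obtain u v where e: "e = (u, v)" by (cases e)
    have uv: "u \<in> V" "v \<in> V" "\<alpha> u < \<alpha> v" "active u v \<noteq> {}"
      using eD unfolding D_def edges_def e by auto
    obtain p where "p \<in> live u" "\<forall>t\<in>active u v. p < t"
      using eD unfolding D_def R_def e by (auto simp: not_le)
    moreover obtain q where "q \<in> live v" "\<forall>t\<in>active u v. q < t"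
      using eD unfolding D_def L_def e by (auto simp: not_le)
    ultimately show ?thesis using edge_born_at_death[OF uv, of p q] unfolding e by auto
  qed
  then obtain W where W: "\<And>e. e \<in> D \<Longrightarrow> W e \<in> V \<and> \<alpha> (fst e) < \<alpha> (W e) \<and> \<alpha> (W e) < \<alpha> (snd e) \<and>
      (\<forall>t\<in>active (fst e) (snd e). \<forall>r\<in>live (W e). r < t) \<and>
      (\<forall>y<Inf (active (fst e) (snd e)). \<exists>r\<in>live (W e). y < r)" by metis
  \<comment> \<open>The life of the charged site reaches up to the infimum of either adjacency but
    lies below all heights of either, so equal charges force equal infima.\<close>
  have Inf_le: "Inf (active u' v') \<le> Inf (active u v)"
    if D: "(u, v) \<in> D" "(u', v') \<in> D" "W (u, v) = W (u', v')" for u v u' v'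
  proof (rule ccontr)
    assume "\<not> ?thesis"
    then have lt: "Inf (active u v) < Inf (active u' v')" by simp
    then obtain r where r: "r \<in> live (W (u, v))" "Inf (active u v) < r"
      using W[OF D(2)] D(3) by auto
    have "active u v \<noteq> {}" using D(1) unfolding D_def edges_def by auto
    then obtain t where "t \<in> active u v" "t < r" using r(2) cInf_lessD by blast
    then show False using W[OF D(1)] r(1) by force
  qed
  have "inj_on W D"
  proof (rule inj_onI, clarify)
    fix u v u' v' assume uv: "(u, v) \<in> D" "(u', v') \<in> D" "W (u, v) = W (u', v')"
    then have e: "u \<in> V" "v \<in> V" "u' \<in> V" "v' \<in> V" "\<alpha> u < \<alpha> v" "\<alpha> u' < \<alpha> v'"
      "active u v \<noteq> {}" "active u' v' \<noteq> {}" unfolding D_def edges_def by auto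
    have eqI: "Inf (active u v) = Inf (active u' v')"
      using Inf_le[OF uv] Inf_le[OF uv(2,1) uv(3)[symmetric]] by simp
    \<comment> \<open>By \<open>active_extends_down\<close> an active height is never the infimum,
      so another adjacency with the same infimum has heights below it.\<close>
    have below: "\<exists>s\<in>active a b. s \<le> t"
      if D: "(a, b) \<in> D" "(c, d) \<in> D" "W (a, b) = W (c, d)" "Inf (active a b) = Inf (active c d)" "t \<in> active c d"
      for a b c d t
    proof -
      have "\<alpha> c < \<alpha> d" and ne: "active a b \<noteq> {}" using D(1,2) unfolding D_def edges_def by auto
      then obtain t' where t': "t' < t" "t' \<in> active c d" using active_extends_down[of t c d] D(5) by auto
      have "bdd_below (active c d)"
      proof -
        obtain r where "r \<in> live (W (c, d))" using W[OF D(2)] lt_ex by (metis fst_conv snd_conv)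
        then show ?thesis using W[OF D(2)] by (intro bdd_belowI[of _ r]) (auto intro: less_imp_le)
      qed
      then have "Inf (active c d) \<le> t'" using t'(2) by (rule cInf_lower[rotated])
      then have "Inf (active a b) < t" using t'(1) D(4) by simp
      then show ?thesis using cInf_lessD[OF ne] by (meson less_imp_le)
    qed
    have "active u v \<inter> active u' v' \<noteq> {}"
      using below[OF uv eqI] below[OF uv(2,1) uv(3)[symmetric] eqI[symmetric]] e(7,8)
      by (intro coinitial_meet convex_active) auto
    then obtain t where t: "t \<in> active u v" "t \<in> active u' v'" by auto
    have "\<alpha> u < \<alpha> (W (u, v))" "\<alpha> (W (u, v)) < \<alpha> v" "\<alpha> u' < \<alpha> (W (u, v))" "\<alpha> (W (u, v)) < \<alpha> v'"
      using W[OF uv(1)] W[OF uv(2)] uv(3) by auto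
    then show "u = u' \<and> v = v'"
      using active_unique[OF e(1-4) t, of "\<alpha> (W (u, v))"] by auto
  qed
  moreover have "W ` D \<subseteq> V" using W by auto
  ultimately have cD: "card D \<le> card V" using finV by (metis card_image card_mono)
  have "edges \<subseteq> R \<union> L \<union> D" unfolding D_def by auto
  then have "card edges \<le> card (R \<union> L \<union> D)"
    using \<open>finite R\<close> \<open>finite L\<close> \<open>finite D\<close> by (intro card_mono) auto
  also have "\<dots> \<le> card R + card L + card D"
    by (meson card_Un_le add_mono_thms_linordered_semiring(3) order_trans)
  finally show "card edges < 3 * card V" using cR cL cD by simp
qed

end

section \<open>Sparse graphs: a forest plus outdegree two\<close>

text \<open>Ownership is read as an orientation: an edge points from its owner to its other
  endpoint.\<close>

definition outs :: "'e set set \<Rightarrow> ('e set \<Rightarrow> 'e) \<Rightarrow> 'e \<Rightarrow> 'e set set" where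
  "outs E own v = {e \<in> E. own e = v}"

definition arc :: "'e set set \<Rightarrow> ('e set \<Rightarrow> 'e) \<Rightarrow> 'e \<Rightarrow> 'e \<Rightarrow> bool" where
  "arc E own v w \<longleftrightarrow> v \<noteq> w \<and> {v, w} \<in> E \<and> own {v, w} = v"

text \<open>Handing each edge of a directed path to its next vertex changes outdegrees only at the
  two ends; the summands on both sides avoid natural subtraction. The clause on other edges tells
  the induction that the first edge is untouched when the tail is flipped.\<close>

lemma flip_path:
  assumes "finite E" and "\<forall>e\<in>E. own e \<in> e" and "successively (arc E own) (a # xs)" and "distinct (a # xs)"
  shows "\<exists>own'. (\<forall>e\<in>E. own' e \<in> e) \<and> (\<forall>e. \<not> e \<subseteq> set (a # xs) \<longrightarrow> own' e = own e) \<and>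
    (\<forall>v. card (outs E own' v) + (if v = a then 1 else 0) =
         card (outs E own v) + (if v = last (a # xs) then 1 else 0))"
  using assms(3,4)
proof (induction xs arbitrary: a)
  case Nil
  then show ?case using assms(2) by auto
next
  case (Cons b xs)
  then have "successively (arc E own) (b # xs)" "distinct (b # xs)" and ab: "arc E own a b" by auto
  from Cons.IH[OF this(1,2)] obtain o1 where o1: "\<forall>e\<in>E. o1 e \<in> e"
    "\<forall>e. \<not> e \<subseteq> set (b # xs) \<longrightarrow> o1 e = own e"
    "\<And>v. card (outs E o1 v) + (if v = b then 1 else 0) = card (outs E own v) + (if v = last (b # xs) then 1 else 0)"
    by auto
  have ne: "a \<noteq> b" and E: "{a, b} \<in> E" and own: "own {a, b} = a" using ab unfolding arc_def by auto
  have "\<not> {a, b} \<subseteq> set (b # xs)" using Cons.prems(2) by auto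
  then have o1ab: "o1 {a, b} = a" using o1(2)[rule_format, of "{a, b}"] own by simp
  define o2 where "o2 = o1({a, b} := b)"
  have fin: "finite (outs E o1 v)" for v using assms(1) unfolding outs_def by simp
  have outs_a: "outs E o2 a = outs E o1 a - {{a, b}}" unfolding outs_def o2_def using ne by auto
  have outs_b: "outs E o2 b = insert {a, b} (outs E o1 b)" unfolding outs_def o2_def using E by auto
  have outs_v: "outs E o2 v = outs E o1 v" if "v \<noteq> a" "v \<noteq> b" for v
    unfolding outs_def o2_def using o1ab that by auto
  have "{a, b} \<in> outs E o1 a" "{a, b} \<notin> outs E o1 b" unfolding outs_def using E o1ab ne by auto
  note in_out = this
  then have "card (outs E o2 a) + 1 = card (outs E o1 a)" "card (outs E o2 b) = card (outs E o1 b) + 1"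
    unfolding outs_a outs_b using card.remove[OF fin in_out(1)] card_insert_disjoint[OF fin in_out(2)] by simp_all
  then have "card (outs E o2 v) + (if v = a then 1 else 0) = card (outs E o1 v) + (if v = b then 1 else 0)" for v
    using outs_v[of v] ne by (cases "v = a"; cases "v = b") auto
  then have "card (outs E o2 v) + (if v = a then 1 else 0) =
      card (outs E own v) + (if v = last (a # b # xs) then 1 else 0)" for v
    using o1(3)[of v] by simp
  moreover have "\<forall>e\<in>E. o2 e \<in> e" using o1(1) unfolding o2_def by simp
  moreover have "\<forall>e. \<not> e \<subseteq> set (a # b # xs) \<longrightarrow> o2 e = own e"
    using o1(2) unfolding o2_def by auto
  ultimately show ?case by blast
qed

lemma rtranclp_distinct_path:
  assumes "R\<^sup>*\<^sup>* a x"
  shows "\<exists>xs. successively R (a # xs) \<and> distinct (a # xs) \<and> last (a # xs) = x"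
  using assms
proof (induction rule: converse_rtranclp_induct)
  case base
  then show ?case by (intro exI[of _ "[]"]) simp
next
  case (step a b)
  then obtain xs where xs: "successively R (b # xs)" "distinct (b # xs)" "last (b # xs) = x" by blast
  show ?case
  proof (cases "a \<in> set (b # xs)")
    case True
    then obtain ys zs where eq: "b # xs = ys @ a # zs" by (meson split_list)
    have "successively R (a # zs)" using xs(1) unfolding eq by (simp add: successively_append_iff)
    moreover have "distinct (a # zs)" using xs(2) unfolding eq by simp
    moreover have "last (a # zs) = x" using xs(3) unfolding eq by simp
    ultimately show ?thesis by blast
  next
    case False
    then show ?thesis using xs step(1) by (intro exI[of _ "b # xs"]) auto
  qed
qed

section \<open>Reorienting sparse graphs along paths\<close>

locale sparse_graph =
  fixes P :: "'a set" and E :: "'a set set"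
  assumes finP: "finite P" and edges: "edge_set_on P E"
    and sparse: "\<And>V. V \<subseteq> P \<Longrightarrow> V \<noteq> {} \<Longrightarrow> card {e \<in> E. e \<subseteq> V} < 3 * card V"
begin

lemma finE: "finite E"
proof -
  have "E \<subseteq> Pow P" using edges unfolding edge_set_on_def by auto
  then show ?thesis using finP finite_subset by blast
qed

lemma edgeE:
  assumes "e \<in> E" "v \<in> e"
  obtains w where "e = {v, w}" "v \<noteq> w" "v \<in> P" "w \<in> P"
proof -
  obtain a b where "a \<in> P" "b \<in> P" "a \<noteq> b" "e = {a, b}"
    using assms(1) edges unfolding edge_set_on_def by auto
  then show ?thesis using assms(2) that[of a] that[of b] by (auto simp: insert_commute)
qed

text \<open>The vertices reachable from \<open>a\<close> are closed under arcs, so every edge owned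
  by one of them lies inside; outdegree at least 3 throughout would contradict
  \<open>sparse\<close>.\<close>

lemma reaches_low_outdegree:
  assumes own: "\<forall>e\<in>E. own e \<in> e" and "a \<in> P"
  shows "\<exists>x\<in>P. (arc E own)\<^sup>*\<^sup>* a x \<and> card (outs E own x) \<le> 2"
proof (rule ccontr)
  assume none: "\<not> ?thesis"
  define V where "V = {x. (arc E own)\<^sup>*\<^sup>* a x}"
  have closed: "w \<in> V" if "v \<in> V" "arc E own v w" for v w
    using that unfolding V_def by (auto intro: rtranclp.rtrancl_into_rtrancl)
  have "x \<in> P" if "(arc E own)\<^sup>*\<^sup>* a x" for x
    using that
  proof (induction rule: rtranclp_induct)
    case (step y z)
    then have "{y, z} \<in> E" unfolding arc_def by simp
    then show ?case by (rule edgeE[of _ z]) auto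
  qed (rule assms(2))
  then have VP: "V \<subseteq> P" unfolding V_def by auto
  then have finV: "finite V" using finP finite_subset by blast
  have "3 * card V = (\<Sum>v\<in>V. 3)" by simp
  also have "\<dots> \<le> (\<Sum>v\<in>V. card (outs E own v))"
    using none VP by (intro sum_mono) (auto simp: V_def not_le)
  also have "\<dots> = card (\<Union>v\<in>V. outs E own v)"
    using finV finE by (intro card_UN_disjoint[symmetric]) (auto simp: outs_def)
  also have "\<dots> \<le> card {e \<in> E. e \<subseteq> V}"
  proof (rule card_mono)
    show "finite {e \<in> E. e \<subseteq> V}" using finE by simp
    show "(\<Union>v\<in>V. outs E own v) \<subseteq> {e \<in> E. e \<subseteq> V}"
    proof clarify
      fix v e assume v: "v \<in> V" "e \<in> outs E own v"
      then have e: "e \<in> E" "own e = v" unfolding outs_def by auto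
      then obtain w where w: "e = {v, w}" "v \<noteq> w" using own edgeE by metis
      then have "w \<in> V" using closed[OF v(1)] e unfolding arc_def by auto
      then show "e \<in> E \<and> e \<subseteq> V" using e(1) w v(1) by auto
    qed
  qed
  finally show False using sparse[OF VP] unfolding V_def by auto
qed

lemma orientation_three:
  "\<exists>own. (\<forall>e\<in>E. own e \<in> e) \<and> (\<forall>v\<in>P. card (outs E own v) \<le> 3)"
proof -
  \<comment> \<open>Total excess over 3, with truncated subtraction. Flipping a path from an
    overloaded vertex to one of outdegree at most 2 creates no excess at its end, so a minimizer of
    \<open>F\<close> has no overloaded vertex.\<close>
  define F where "F own = (\<Sum>v\<in>P. card (outs E own v) - 3)" for own
  have "\<exists>own. \<forall>e\<in>E. own e \<in> e"
  proof (intro exI ballI)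
    fix e assume "e \<in> E"
    then have "\<exists>v. v \<in> e" using edges unfolding edge_set_on_def by auto
    then show "(SOME v. v \<in> e) \<in> e" by (rule someI_ex)
  qed
  then obtain own0 where "\<forall>e\<in>E. own0 e \<in> e" by blast
  from ex_has_least_nat[of "\<lambda>own. \<forall>e\<in>E. own e \<in> e", OF this, of F]
  obtain own where own: "\<forall>e\<in>E. own e \<in> e"
    and least: "\<And>own'. \<forall>e\<in>E. own' e \<in> e \<Longrightarrow> F own \<le> F own'" by blast
  have "card (outs E own a) \<le> 3" if a: "a \<in> P" for a
  proof (rule ccontr)
    assume big: "\<not> ?thesis"
    obtain x where x: "x \<in> P" "(arc E own)\<^sup>*\<^sup>* a x" "card (outs E own x) \<le> 2"
      using reaches_low_outdegree[OF own a] by blast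
    obtain xs where xs: "successively (arc E own) (a # xs)" "distinct (a # xs)" "last (a # xs) = x"
      using rtranclp_distinct_path[OF x(2)] by blast
    obtain own' where own': "\<forall>e\<in>E. own' e \<in> e" and
      deg: "\<And>v. card (outs E own' v) + (if v = a then 1 else 0) =
         card (outs E own v) + (if v = x then 1 else 0)"
      using flip_path[OF finE own xs(1,2)] unfolding xs(3) by blast
    have "F own' < F own"
      unfolding F_def
    proof (rule sum_strict_mono_ex1[OF finP])
      show "\<forall>v\<in>P. card (outs E own' v) - 3 \<le> card (outs E own v) - 3"
      proof
        fix v
        show "card (outs E own' v) - 3 \<le> card (outs E own v) - 3"
          using deg[of v] x(3) by (cases "v = x"; cases "v = a") auto
      qed
      show "\<exists>v\<in>P. card (outs E own' v) - 3 < card (outs E own v) - 3"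
        using deg[of a] x(3) big a by (intro bexI[of _ a]) (auto split: if_splits)
    qed
    then show False using least[OF own'] by simp
  qed
  then show ?thesis using own by blast
qed

text \<open>Each vertex outside the root set \<open>R\<close> gives one arc to the forest, namely
  the first arc of a shortest path to \<open>R\<close>. The rank, the length of that path, excludes
  cycles; every vertex keeps at most two arcs outside the forest.\<close>

lemma forest_plus_two:
  "\<exists>own R par. (\<forall>e\<in>E. own e \<in> e) \<and> R \<subseteq> P \<and> (\<forall>v\<in>R. card (outs E own v) \<le> 2) \<and>
    (\<forall>v\<in>P - R. par v \<in> P \<and> arc E own v (par v) \<and> card (outs E own v) \<le> 3) \<and>
    (\<exists>rank :: 'a \<Rightarrow> nat. \<forall>v\<in>P - R. rank (par v) < rank v)"
proof -
  obtain own where own: "\<forall>e\<in>E. own e \<in> e" and three: "\<forall>v\<in>P. card (outs E own v) \<le> 3"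
    using orientation_three by blast
  define R where "R = {v \<in> P. card (outs E own v) \<le> 2}"
  define rank where "rank v = (LEAST n. \<exists>x\<in>R. (arc E own ^^ n) v x)" for v
  have "\<exists>w. w \<in> P \<and> arc E own v w \<and> rank w < rank v" if v: "v \<in> P - R" for v
  proof -
    have "\<exists>x\<in>R. (arc E own)\<^sup>*\<^sup>* v x" using reaches_low_outdegree[OF own] v unfolding R_def by blast
    then have "\<exists>n. \<exists>x\<in>R. (arc E own ^^ n) v x" by (metis rtranclp_power)
    then have "\<exists>x\<in>R. (arc E own ^^ rank v) v x" unfolding rank_def by (rule LeastI_ex)
    then obtain x where x: "x \<in> R" "(arc E own ^^ rank v) v x" by blast
    have "rank v \<noteq> 0" using x v by (metis DiffD2 relpowp_0_E)
    then obtain n where n: "rank v = Suc n" by (cases "rank v") auto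
    then obtain w where w: "arc E own v w" "(arc E own ^^ n) w x"
      using x(2) by (metis relpowp_Suc_D2)
    have "rank w \<le> n" unfolding rank_def using w(2) x(1) by (intro Least_le) blast
    moreover have "w \<in> P" using w(1) edges unfolding arc_def edge_set_on_def by (metis doubleton_eq_iff)
    ultimately show ?thesis using w(1) n by auto
  qed
  then obtain par where "\<forall>v\<in>P - R. par v \<in> P \<and> arc E own v (par v) \<and> rank (par v) < rank v" by metis
  then show ?thesis using own three
    by (intro exI[of _ own] exI[of _ R] exI[of _ par]) (auto simp: R_def)
qed

end

section \<open>Distributing the edges\<close>

text \<open>Abstract form of the best-response numbers: one more lost edge costs at most one, losing
  more never helps, and optimality enters only through \<open>sparse\<close> and
  \<open>exchange\<close>.\<close>

locale exchange_graph = sparse_graph +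
  fixes br :: "'a \<Rightarrow> 'a set set \<Rightarrow> nat"
  assumes br_empty: "v \<in> P \<Longrightarrow> br v {} = 0"
    and br_insert: "v \<in> P \<Longrightarrow> D \<subseteq> {e \<in> E. v \<in> e} \<Longrightarrow> e \<in> E \<Longrightarrow> v \<in> e \<Longrightarrow> br v (insert e D) \<le> br v D + 1"
    and br_mono: "v \<in> P \<Longrightarrow> C \<subseteq> D \<Longrightarrow> D \<subseteq> {e \<in> E. v \<in> e} \<Longrightarrow> br v C \<le> br v D"
    and exchange: "D \<subseteq> E \<Longrightarrow> card D \<le> (\<Sum>v\<in>P. br v {e \<in> D. v \<in> e})"
begin

text \<open>Every vertex ends up with at most two edges outside the forest and a set
  \<open>F\<close> of forest edges with \<open>card F <= br v F\<close>; monotonicity of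
  \<open>br\<close> then yields the bound.\<close>

lemma assignment_within_two:
  "\<exists>own. (\<forall>e\<in>E. own e \<in> e) \<and> (\<forall>v\<in>P. card (outs E own v) \<le> br v (outs E own v) + 2)"
proof -
  obtain own R par rank where own: "\<forall>e\<in>E. own e \<in> e" and RP: "R \<subseteq> P"
    and two: "\<And>v. v \<in> R \<Longrightarrow> card (outs E own v) \<le> 2"
    and parP: "\<And>v. v \<in> P - R \<Longrightarrow> par v \<in> P" and arc: "\<And>v. v \<in> P - R \<Longrightarrow> arc E own v (par v)"
    and three: "\<And>v. v \<in> P - R \<Longrightarrow> card (outs E own v) \<le> 3"
    and rank: "\<And>v. v \<in> P - R \<Longrightarrow> rank (par v) < (rank v :: nat)"
    using forest_plus_two by blast
  define f where "f v = {v, par v}" for v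
  have fE: "f v \<in> E" "own (f v) = v" "v \<noteq> par v" if "v \<in> P - R" for v
    using arc[OF that] unfolding arc_def f_def by auto
  have injf: "inj_on f (P - R)" using fE(2) by (metis inj_onI)
  define Ch where "Ch U v = {c \<in> U. par c = v}" for U v
  define good where "good U \<longleftrightarrow> U \<subseteq> P - R \<and> (\<forall>v\<in>U. br v (insert (f v) (f ` Ch U v)) \<le> card (Ch U v))" for U
  txt \<open>
    The vertices of \<open>U\<close> pass the edge to their parent upwards because they cannot afford it on top of the
    edges received from their children in \<open>U\<close>.
  \<close>
  have "good {}" unfolding good_def by simp
  moreover have "finite {U. good U}"
    by (rule finite_subset[of _ "Pow P"]) (use finP in \<open>auto simp: good_def\<close>)
  ultimately obtain U where U: "good U" and maxU: "\<And>U'. good U' \<Longrightarrow> U \<subseteq> U' \<Longrightarrow> U' = U"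
    using finite_has_maximal[of "{U. good U}"] by fastforce
  have UP: "U \<subseteq> P - R" using U unfolding good_def by simp
  then have finU: "finite U" using finP finite_subset by blast
  have finCh: "finite (Ch U v)" for v using finU unfolding Ch_def by simp
  have ChE: "f ` Ch U v \<subseteq> {e \<in> E. v \<in> e}" for v
    using UP fE(1) unfolding Ch_def f_def by auto
  have cardCh: "card (f ` Ch U v) = card (Ch U v)" for v
    by (rule card_image, rule inj_on_subset[OF injf]) (use UP in \<open>auto simp: Ch_def\<close>)
  \<comment> \<open>Otherwise \<open>insert v U\<close> would be good as well: besides the new
    condition at \<open>v\<close> only the one at \<open>par v\<close> can change, where the count
    of children grows by one and \<open>br\<close> by at most one.\<close>
  have down: "card (Ch U v) < br v (insert (f v) (f ` Ch U v))" if v: "v \<in> P - R - U" for v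
  proof (rule ccontr)
    assume le: "\<not> ?thesis"
    define U' where "U' = insert v U"
    have vP: "v \<in> P - R" and ne: "par v \<noteq> v" using v fE(3)[of v] by auto
    have Ch': "Ch U' (par v) = insert v (Ch U (par v))" "v \<notin> Ch U (par v)"
      using v unfolding Ch_def U'_def by auto
    have Ch_same: "Ch U' w = Ch U w" if "w \<noteq> par v" for w using that unfolding Ch_def U'_def by auto
    have "br w (insert (f w) (f ` Ch U' w)) \<le> card (Ch U' w)" if w: "w \<in> U'" for w
    proof (cases "w = par v")
      case False
      show ?thesis
      proof (cases "w = v")
        case True
        then show ?thesis using le Ch_same[OF False] by simp
      next
        case False
        then show ?thesis using Ch_same[OF \<open>w \<noteq> par v\<close>] w U unfolding good_def U'_def by auto
      qed
    next
      case True
      then have wU: "w \<in> U" using w ne unfolding U'_def by auto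
      then have wP: "w \<in> P - R" using UP by auto
      have "br w (insert (f v) (insert (f w) (f ` Ch U w))) \<le> br w (insert (f w) (f ` Ch U w)) + 1"
        using fE(1)[OF vP] fE(1)[OF wP] ChE[of w] wP True by (intro br_insert) (auto simp: f_def)
      also have "\<dots> \<le> card (Ch U w) + 1" using U wU unfolding good_def by auto
      also have "\<dots> = card (Ch U' w)" using Ch' finCh[of w] unfolding True by simp
      finally show ?thesis using Ch' unfolding True by (simp add: insert_commute)
    qed
    then have "good U'" using vP UP unfolding good_def U'_def by auto
    then show False using maxU[of U'] v unfolding U'_def by auto
  qed
  have up: "card (Ch U v) \<le> br v (f ` Ch U v)" if v: "v \<in> P" for v
  proof (rule ccontr)
    assume lt: "\<not> ?thesis"
    txt \<open>
      The edges passed upwards inside the branch below \<open>v\<close> are too many: every vertex of that branch can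
      replace its own edge and those of its children at the price of one edge per child.
    \<close>
    define p where "p c w \<longleftrightarrow> c \<in> U \<and> par c = w" for c w
    define X where "X = {x. p\<^sup>+\<^sup>+ x v}"
    have XU: "X \<subseteq> U"
    proof
      fix x assume "x \<in> X"
      then have "p\<^sup>+\<^sup>+ x v" unfolding X_def by simp
      then show "x \<in> U" by (cases rule: tranclp.cases[of p x v]) (auto simp: p_def dest: tranclpD)
    qed
    then have XP: "X \<subseteq> P - R" using UP by auto
    have finX: "finite X" using XU finU finite_subset by blast
    \<comment> \<open>Since ranks drop towards parents, \<open>v\<close> is not its own descendant,
      so \<open>D\<close> below meets \<open>v\<close> only in edges from its children.\<close>
    have "rank v < rank x" if "p\<^sup>+\<^sup>+ x v" for x
      using that
    proof (induction rule: converse_tranclp_induct)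
      case (base y)
      then show ?case using rank UP unfolding p_def by auto
    next
      case (step y z)
      then have "rank z < rank y" using rank UP unfolding p_def by auto
      then show ?case using step by simp
    qed
    then have vX: "v \<notin> X" unfolding X_def by auto
    define Y where "Y = insert v X"
    have Xeq: "X = {c \<in> U. par c \<in> Y}"
    proof (rule equalityI)
      show "X \<subseteq> {c \<in> U. par c \<in> Y}"
      proof
        fix x assume x: "x \<in> X"
        then have "p\<^sup>+\<^sup>+ x v" unfolding X_def by simp
        then obtain y where "p x y" "y = v \<or> p\<^sup>+\<^sup>+ y v" by (auto elim: converse_tranclpE)
        then have "par x \<in> Y" unfolding Y_def X_def p_def by auto
        then show "x \<in> {c \<in> U. par c \<in> Y}" using x XU by auto
      qed
      show "{c \<in> U. par c \<in> Y} \<subseteq> X"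
      proof clarify
        fix c assume c: "c \<in> U" "par c \<in> Y"
        then have "p c (par c)" unfolding p_def by simp
        then show "c \<in> X" using c(2) unfolding X_def Y_def by (auto intro: tranclp_into_tranclp2)
      qed
    qed
    have YP: "Y \<subseteq> P" using v XP unfolding Y_def by auto
    have finY: "finite Y" using finX unfolding Y_def by simp
    define D where "D = f ` X"
    have DE: "D \<subseteq> E" using fE(1) XP unfolding D_def by auto
    have "inj_on f X" using injf XP inj_on_subset by blast
    then have "card D = card X" unfolding D_def by (rule card_image)
    also have "\<dots> = (\<Sum>y\<in>Y. card (Ch U y))"
    proof -
      have "X = (\<Union>y\<in>Y. Ch U y)" using Xeq unfolding Ch_def by auto
      also have "card \<dots> = (\<Sum>y\<in>Y. card (Ch U y))"
        using finY finCh by (intro card_UN_disjoint) (auto simp: Ch_def)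
      finally show ?thesis .
    qed
    finally have cD: "card D = (\<Sum>y\<in>Y. card (Ch U y))" .
    \<comment> \<open>With this description, \<open>good\<close> bounds \<open>br\<close> on
      \<open>X\<close>, the negated claim bounds it strictly at \<open>v\<close>, and vertices
      outside \<open>Y\<close> meet no edge of \<open>D\<close>. Summing contradicts
      \<open>exchange\<close>.\<close>
    have at: "{e \<in> D. y \<in> e} = (if y \<in> X then {f y} else {}) \<union> (if y \<in> Y then f ` Ch U y else {})" for y
    proof -
      have "{e \<in> D. y \<in> e} = f ` {x \<in> X. x = y} \<union> f ` {x \<in> X. par x = y}"
        unfolding D_def f_def by auto
      moreover have "{x \<in> X. par x = y} = (if y \<in> Y then Ch U y else {})"
        using Xeq unfolding Ch_def by auto
      ultimately show ?thesis by auto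
    qed
    have "card D \<le> (\<Sum>y\<in>P. br y {e \<in> D. y \<in> e})" using exchange[OF DE] .
    also have "\<dots> = (\<Sum>y\<in>Y. br y {e \<in> D. y \<in> e})"
    proof (rule sum.mono_neutral_right[OF finP YP])
      show "\<forall>y\<in>P - Y. br y {e \<in> D. y \<in> e} = 0"
        unfolding at using br_empty by (auto simp: Y_def)
    qed
    also have "\<dots> < (\<Sum>y\<in>Y. card (Ch U y))"
    proof (rule sum_strict_mono_ex1[OF finY])
      show "\<forall>y\<in>Y. br y {e \<in> D. y \<in> e} \<le> card (Ch U y)"
      proof
        fix y assume y: "y \<in> Y"
        show "br y {e \<in> D. y \<in> e} \<le> card (Ch U y)"
        proof (cases "y \<in> X")
          case True
          then show ?thesis using U XU y unfolding at good_def by auto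
        next
          case False
          then have "y = v" using y unfolding Y_def by auto
          then show ?thesis using lt y False unfolding at by auto
        qed
      qed
      show "\<exists>y\<in>Y. br y {e \<in> D. y \<in> e} < card (Ch U y)"
        using lt vX unfolding at by (intro bexI[of _ v]) (auto simp: Y_def)
    qed
    finally show False using cD by simp
  qed
  define own' where "own' e = (if e \<in> f ` U then par (the_inv_into U f e) else own e)" for e
  have injU: "inj_on f U" using injf UP inj_on_subset by blast
  have own'_f: "own' (f c) = par c" if "c \<in> U" for c
    using that the_inv_into_f_f[OF injU that] unfolding own'_def by auto
  have own'_other: "own' e = own e" if "e \<notin> f ` U" for e using that unfolding own'_def by simp
  have valid: "\<forall>e\<in>E. own' e \<in> e"
  proof
    fix e assume "e \<in> E"
    then show "own' e \<in> e" using own own'_other[of e] own'_f by (cases "e \<in> f ` U") (auto simp: f_def)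
  qed
  have "card (outs E own' v) \<le> br v (outs E own' v) + 2" if v: "v \<in> P" for v
  proof -
    have finO: "finite (outs E own v)" using finE unfolding outs_def by simp
    have sub: "outs E own' v \<subseteq> {e \<in> E. v \<in> e}" using valid unfolding outs_def by auto
    have split: "outs E own' v = (outs E own v - f ` U) \<union> f ` Ch U v"
    proof
      show "outs E own' v \<subseteq> (outs E own v - f ` U) \<union> f ` Ch U v"
      proof
        fix e assume e: "e \<in> outs E own' v"
        show "e \<in> (outs E own v - f ` U) \<union> f ` Ch U v"
        proof (cases "e \<in> f ` U")
          case True
          then obtain c where "c \<in> U" "e = f c" by auto
          then show ?thesis using own'_f[of c] e unfolding outs_def Ch_def by auto
        next
          case False
          then show ?thesis using e own'_other unfolding outs_def by auto
        qed
      qed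
      show "(outs E own v - f ` U) \<union> f ` Ch U v \<subseteq> outs E own' v"
        using own'_f own'_other fE(1) UP unfolding outs_def Ch_def by auto
    qed
    \<comment> \<open>\<open>Q\<close> holds the edges outside the forest and \<open>C\<close> the
      parent edge if it is kept: \<open>C\<close> is empty on \<open>R\<close> and \<open>U\<close>,
      where \<open>up\<close> suffices, and \<open>{f v}\<close> elsewhere, where
      \<open>down\<close> pays for it.\<close>
    have rest: ?thesis if Q: "outs E own v - f ` U = Q \<union> C" "card Q \<le> 2" "finite Q" "finite C"
        "card (C \<union> f ` Ch U v) \<le> br v (C \<union> f ` Ch U v)" for Q C
    proof -
      have eq: "outs E own' v = Q \<union> (C \<union> f ` Ch U v)" using split Q(1) by auto
      have "card (outs E own' v) \<le> card Q + card (C \<union> f ` Ch U v)" unfolding eq by (rule card_Un_le)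
      also have "\<dots> \<le> 2 + br v (C \<union> f ` Ch U v)" using Q by simp
      also have "br v (C \<union> f ` Ch U v) \<le> br v (outs E own' v)"
        using sub eq by (intro br_mono[OF v]) auto
      finally show ?thesis by simp
    qed
    consider "v \<in> R" | "v \<in> U" | "v \<in> P - R - U" using v by auto
    then show ?thesis
    proof cases
      case 1
      have "card (outs E own v - f ` U) \<le> card (outs E own v)" using finO by (intro card_mono) auto
      also have "\<dots> \<le> 2" using two[OF 1] .
      finally show ?thesis
        using finO up[OF v] cardCh by (intro rest[of "outs E own v - f ` U" "{}"]) auto
    next
      case 2
      then have vP: "v \<in> P - R" using UP by auto
      have "card (outs E own v - f ` U) \<le> card (outs E own v - {f v})"
        using finO 2 by (intro card_mono) auto
      also have "\<dots> \<le> 2" using three[OF vP] fE[OF vP] finO by (subst card_Diff_singleton) (auto simp: outs_def)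
      finally show ?thesis
        using finO up[OF v] cardCh by (intro rest[of "outs E own v - f ` U" "{}"]) auto
    next
      case 3
      then have vP: "v \<in> P - R" by auto
      have notU: "f v \<notin> f ` U"
        using 3 fE(2)[OF vP] fE(2) UP by (metis Diff_iff imageE subsetD)
      show ?thesis
      proof (rule rest[of "outs E own v - f ` U - {f v}" "{f v}"])
        show "outs E own v - f ` U = (outs E own v - f ` U - {f v}) \<union> {f v}"
          using notU fE[OF vP] unfolding outs_def by auto
        have "card (outs E own v - f ` U - {f v}) \<le> card (outs E own v - {f v})"
          using finO by (intro card_mono) auto
        also have "\<dots> \<le> 2" using three[OF vP] fE[OF vP] finO by (subst card_Diff_singleton) (auto simp: outs_def)
        finally show "card (outs E own v - f ` U - {f v}) \<le> 2" .
        have "card ({f v} \<union> f ` Ch U v) \<le> card (Ch U v) + 1"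
          using card_insert_le_m1 card_Un_le[of "{f v}" "f ` Ch U v"] cardCh by auto
        then show "card ({f v} \<union> f ` Ch U v) \<le> br v ({f v} \<union> f ` Ch U v)"
          using down[OF 3] by simp
      qed (use finO in auto)
    qed
  qed
  then show ?thesis using valid by blast
qed

end

section \<open>Greedy steps in the Delaunay graph\<close>

text \<open>The empty-circle condition in strict form: no third site may lie on the circle, which
  matches \<open>active\<close> in the sweep.\<close>

definition delaunay :: "'p::metric_space set \<Rightarrow> 'p set set" where
  "delaunay V = {{u, v} | u v. u \<in> V \<and> v \<in> V \<and> u \<noteq> v \<and>
     (\<exists>c. dist u c = dist v c \<and> (\<forall>x\<in>V - {u, v}. dist u c < dist x c))}"

lemma dist_square_diff:
  fixes u y c :: "'p::real_inner"
  shows "(dist y c)\<^sup>2 - (dist u c)\<^sup>2 = y \<bullet> y - u \<bullet> u - 2 * (c \<bullet> (y - u))"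
  unfolding dist_norm power2_norm_eq_inner by (simp add: algebra_simps inner_commute)

lemma dist_less_iff_square: "dist u c < dist y c \<longleftrightarrow> (dist u c)\<^sup>2 < (dist y c)\<^sup>2"
  by (auto intro: power_strict_mono dest: power2_less_imp_less)

text \<open>
  The segment from \<open>w\<close> to \<open>u\<close> enters the Voronoi cell of \<open>u\<close> through the bisector of \<open>u\<close> and a site
  closer to \<open>w\<close>. To rule out ties (\<open>M\<close> below), the endpoint \<open>u\<close> is moved slightly towards the nearest tied site.
\<close>

lemma delaunay_greedy_step:
  fixes u w :: "'p::real_inner"
  assumes fin: "finite V" and u: "u \<in> V" and v: "v \<in> V" "dist v w < dist u w"
  shows "\<exists>x. {u, x} \<in> delaunay V \<and> dist x w < dist u w"
proof -
  \<comment> \<open>Affine in \<open>c\<close>; the cell of \<open>u\<close> is the region where no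
    \<open>H y\<close> is negative.\<close>
  define H where "H y c = (dist y c)\<^sup>2 - (dist u c)\<^sup>2" for y c
  have H: "H y c = y \<bullet> y - u \<bullet> u - 2 * (c \<bullet> (y - u))" for y c
    unfolding H_def by (rule dist_square_diff)
  have H_convex: "H y ((1 - l) *\<^sub>R a + l *\<^sub>R b) = (1 - l) * H y a + l * H y b" for y a b l
    unfolding H by (simp add: algebra_simps)
  have Huu: "H y u = (norm (y - u))\<^sup>2" for y
    unfolding H_def dist_norm by simp
  define B where "B = {y \<in> V. H y w < 0}"
  have finB: "finite B" using fin unfolding B_def by simp
  have "v \<in> B" using v unfolding B_def H_def dist_less_iff_square by simp
  have uB: "u \<notin> B" unfolding B_def H_def by simp
  define k where "k y = - H y w" for y
  have k: "k y > 0" if "y \<in> B" for y using that unfolding k_def B_def by simp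
  \<comment> \<open>On the segment from \<open>w\<close> to \<open>u\<close>, \<open>H y\<close>
    vanishes where the weight \<open>l\<close> of \<open>u\<close> satisfies
    \<open>(1 - l) / l = \<rho> y\<close>, so the minimizers of \<open>\<rho>\<close> have the
    bisectors crossed last.\<close>
  define \<rho> where "\<rho> y = H y u / k y" for y
  define M where "M = {y \<in> B. \<forall>z\<in>B. \<rho> y \<le> \<rho> z}"
  have "M \<noteq> {}"
  proof -
    have "arg_min_on \<rho> B \<in> M"
      unfolding M_def using finB \<open>v \<in> B\<close> by (auto intro: arg_min_least arg_min_if_finite(1))
    then show ?thesis by auto
  qed
  have finM: "finite M" using finB unfolding M_def by simp
  define x where "x = arg_min_on (\<lambda>y. norm (y - u)) M"
  have xM: "x \<in> M" and x_min: "\<And>y. y \<in> M \<Longrightarrow> norm (x - u) \<le> norm (y - u)"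
    unfolding x_def using finM \<open>M \<noteq> {}\<close> by (auto intro: arg_min_least arg_min_if_finite(1))
  have xB: "x \<in> B" and x_rho: "\<And>y. y \<in> B \<Longrightarrow> \<rho> x \<le> \<rho> y" using xM unfolding M_def by auto
  have ne: "norm (y - u) > 0" if "y \<in> B" for y using that uB by auto
  define p where "p e = u + e *\<^sub>R (x - u)" for e
  have Hp: "H y (p e) = H y u + e * (- 2 * ((x - u) \<bullet> (y - u)))" for y e
    unfolding H p_def by (simp add: algebra_simps)
  have pos: "eventually (\<lambda>e. 0 < H y (p e)) (at_right 0)" if "y \<in> V - {u}" for y
    using eventually_affine_less[of 0 "H y u" 0 "- 2 * ((x - u) \<bullet> (y - u))"] that
    unfolding Hp by (simp add: Huu)
  have first: "eventually (\<lambda>e. H x (p e) / k x < H y (p e) / k y) (at_right 0)" if y: "y \<in> B - {x}" for y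
  proof -
    \<comment> \<open>Derivatives of the two quotients in \<open>e\<close>. If \<open>\<rho>\<close>
      ties, then \<open>X < Y\<close> because \<open>x\<close> is nearest to \<open>u\<close> among
      the tied sites.\<close>
    define X Y where "X = - 2 * ((x - u) \<bullet> (x - u)) / k x" and "Y = - 2 * ((x - u) \<bullet> (y - u)) / k y"
    have div: "H x (p e) / k x = \<rho> x + e * X" "H y (p e) / k y = \<rho> y + e * Y" for e
      unfolding Hp \<rho>_def X_def Y_def by (simp_all add: diff_divide_distrib)
    show ?thesis
    proof (cases "\<rho> x < \<rho> y")
      case True
      then show ?thesis unfolding div by (rule eventually_affine_less)
    next
      case False
      then have eq: "\<rho> y = \<rho> x" using x_rho[of y] y by simp
      then have "y \<in> M" using x_rho y unfolding M_def by auto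
      have "(x - u) \<bullet> (y - u) < (norm (y - u))\<^sup>2"
      proof -
        have "0 < (norm ((x - u) - (y - u)))\<^sup>2" using y by auto
        also have "\<dots> = (norm (x - u))\<^sup>2 + (norm (y - u))\<^sup>2 - 2 * ((x - u) \<bullet> (y - u))"
          unfolding power2_norm_eq_inner by (simp add: inner_diff inner_commute)
        finally have "2 * ((x - u) \<bullet> (y - u)) < (norm (x - u))\<^sup>2 + (norm (y - u))\<^sup>2" by simp
        moreover have "(norm (x - u))\<^sup>2 \<le> (norm (y - u))\<^sup>2"
          using x_min[OF \<open>y \<in> M\<close>] by (simp add: power_mono)
        ultimately show ?thesis by linarith
      qed
      then have "(x - u) \<bullet> (y - u) / k y < (norm (y - u))\<^sup>2 / k y"
        using k y by (simp add: divide_strict_right_mono)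
      also have "\<dots> = (x - u) \<bullet> (x - u) / k x"
        using eq unfolding \<rho>_def Huu by (simp add: power2_norm_eq_inner)
      finally have "X < Y" unfolding X_def Y_def by simp
      have "eventually (\<lambda>e::real. 0 < e) (at_right 0)" by (simp add: eventually_at_right_less)
      then show ?thesis
        by (rule eventually_mono) (use \<open>X < Y\<close> in \<open>simp add: div eq\<close>)
    qed
  qed
  have "eventually (\<lambda>e. (\<forall>y\<in>V - {u}. 0 < H y (p e)) \<and>
      (\<forall>y\<in>B - {x}. H x (p e) / k x < H y (p e) / k y)) (at_right 0)"
    using pos first fin finB by (intro eventually_conj eventually_ball_finite) auto
  then obtain e where e: "\<And>y. y \<in> V - {u} \<Longrightarrow> 0 < H y (p e)"
    "\<And>y. y \<in> B - {x} \<Longrightarrow> H x (p e) / k x < H y (p e) / k y"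
    using eventually_happens'[OF trivial_limit_at_right_real] by blast
  have xV: "x \<in> V" "x \<noteq> u" using xB uB unfolding B_def by auto
  \<comment> \<open>The weight of \<open>p e\<close> at which \<open>H x\<close> vanishes on the
    segment from \<open>w\<close> to \<open>p e\<close>.\<close>
  define l where "l = k x / (k x + H x (p e))"
  have den: "k x + H x (p e) > 0" using k[OF xB] e(1)[of x] xV by simp
  have l: "0 < l" "l < 1" and lx: "l * H x (p e) = (1 - l) * k x"
    using k[OF xB] e(1)[of x] xV den unfolding l_def by (auto simp: field_simps)
  define c where "c = (1 - l) *\<^sub>R w + l *\<^sub>R p e"
  have Hc: "H y c = (1 - l) * H y w + l * H y (p e)" for y unfolding c_def by (rule H_convex)
  have "H x c = 0" unfolding Hc using lx unfolding k_def by simp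
  moreover have "0 < H y c" if y: "y \<in> V - {u, x}" for y
  proof (cases "y \<in> B")
    case False
    then have "0 \<le> H y w" using y unfolding B_def by auto
    then have "0 \<le> (1 - l) * H y w" using l by simp
    moreover have "0 < l * H y (p e)" using l e(1)[of y] y by simp
    ultimately show ?thesis unfolding Hc by simp
  next
    case True
    have "l * (H x (p e) / k x) < l * (H y (p e) / k y)" using e(2)[of y] True y l(1) by (intro mult_strict_left_mono) auto
    moreover have "l * (H x (p e) / k x) = 1 - l" using lx k[OF xB] by (simp add: field_simps)
    ultimately have "(1 - l) * k y < l * (H y (p e) / k y) * k y"
      using k[OF True] by (intro mult_strict_right_mono) auto
    then have "(1 - l) * k y < l * H y (p e)" using k[OF True] by simp
    then show ?thesis unfolding Hc k_def by simp
  qed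
  ultimately have "dist u c = dist x c \<and> (\<forall>y\<in>V - {u, x}. dist u c < dist y c)"
    unfolding H_def dist_less_iff_square by (auto simp: power2_eq_iff_nonneg)
  then have "{u, x} \<in> delaunay V" using u xV unfolding delaunay_def by blast
  moreover have "dist x w < dist u w" using xB unfolding B_def H_def dist_less_iff_square by simp
  ultimately show ?thesis by blast
qed

section \<open>Counting Delaunay edges in the plane\<close>

lemma ex_injective_direction:
  fixes V :: "(real^2) set"
  assumes "finite V"
  shows "\<exists>\<epsilon>. inj_on (\<lambda>v. v $ 1 + \<epsilon> * v $ 2) V"
proof -
  \<comment> \<open>Each pair forbids one value; pairs with equal second coordinates forbid only 0,
    as division by 0 gives 0, which does no harm.\<close>
  have "finite ((\<lambda>(u, v). - (u $ 1 - v $ 1) / (u $ 2 - v $ 2)) ` (V \<times> V))" using assms by simp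
  then obtain \<epsilon> where \<epsilon>: "\<epsilon> \<notin> (\<lambda>(u, v). - (u $ 1 - v $ 1) / (u $ 2 - v $ 2)) ` (V \<times> V)"
    using ex_new_if_finite[OF infinite_UNIV_char_0] by blast
  have "inj_on (\<lambda>v. v $ 1 + \<epsilon> * v $ 2) V"
  proof (rule inj_onI)
    fix u v assume uv: "u \<in> V" "v \<in> V" and eq: "u $ 1 + \<epsilon> * u $ 2 = v $ 1 + \<epsilon> * v $ 2"
    have "u $ 2 = v $ 2"
    proof (rule ccontr)
      assume ne: "u $ 2 \<noteq> v $ 2"
      have "\<epsilon> * (u $ 2 - v $ 2) = - (u $ 1 - v $ 1)" using eq by (simp add: algebra_simps)
      then have "\<epsilon> = - (u $ 1 - v $ 1) / (u $ 2 - v $ 2)" using ne by (simp add: eq_divide_eq)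
      then show False using \<epsilon> uv by force
    qed
    then show "u = v" using eq by (simp add: vec_eq_iff forall_2)
  qed
  then show ?thesis by blast
qed

lemma card_delaunay:
  fixes V :: "(real^2) set"
  assumes "finite V" "V \<noteq> {}"
  shows "card (delaunay V) < 3 * card V"
proof -
  obtain \<epsilon> where \<epsilon>: "inj_on (\<lambda>v. v $ 1 + \<epsilon> * v $ 2) V"
    using ex_injective_direction[OF assms(1)] by blast
  \<comment> \<open>Sweep in the sheared coordinates \<open>s = c $ 1\<close> and
    \<open>t = c $ 2 - \<epsilon> * c $ 1\<close>, so that the coefficients of \<open>s\<close> are
    distinct; up to \<open>c \<bullet> c\<close>, \<open>h\<close> is then the squared
    distance.\<close>
  interpret affine_sweep V "\<lambda>v. 2 * (v $ 1 + \<epsilon> * v $ 2)" "\<lambda>v. 2 * v $ 2" "\<lambda>v. v \<bullet> v"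
    using assms(1) \<epsilon> by unfold_locales (auto simp: inj_on_def)
  have dist_h: "(dist v c)\<^sup>2 = h v (c $ 1) (c $ 2 - \<epsilon> * c $ 1) + c \<bullet> c" for v c
    unfolding dist_norm power2_norm_eq_inner h_def
    by (simp add: inner_vec_def sum_2 algebra_simps)
  have "delaunay V \<subseteq> (\<lambda>(u, v). {u, v}) ` edges"
  proof
    fix e assume "e \<in> delaunay V"
    then obtain u v c where e: "e = {u, v}" and V: "u \<in> V" "v \<in> V" "u \<noteq> v"
      and c: "dist u c = dist v c" "\<forall>x\<in>V - {u, v}. dist u c < dist x c"
      unfolding delaunay_def by blast
    define s t where "s = c $ 1" and "t = c $ 2 - \<epsilon> * c $ 1"
    have tie: "h u s t = h v s t"
      using arg_cong[OF c(1), of "\<lambda>d. d\<^sup>2"] unfolding dist_h s_def t_def by simp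
    have less: "\<forall>x\<in>V - {u, v}. h u s t < h x s t"
      using c(2) unfolding dist_less_iff_square dist_h s_def t_def by simp
    have "t \<in> active u v" unfolding active_def using tie less by blast
    moreover have "t \<in> active v u"
    proof -
      have "h v s t = h u s t \<and> (\<forall>x\<in>V - {v, u}. h v s t < h x s t)"
        using tie less by auto
      then show ?thesis unfolding active_def by blast
    qed
    ultimately have "active u v \<noteq> {}" "active v u \<noteq> {}" by auto
    moreover have "u $ 1 + \<epsilon> * u $ 2 \<noteq> v $ 1 + \<epsilon> * v $ 2"
      using V \<epsilon> by (auto dest: inj_onD)
    ultimately have "(u, v) \<in> edges \<or> (v, u) \<in> edges" using V unfolding edges_def by auto
    then show "e \<in> (\<lambda>(u, v). {u, v}) ` edges" unfolding e by (auto simp: insert_commute image_iff)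
  qed
  then have "card (delaunay V) \<le> card edges"
    using card_edges(1)[OF assms(2)] by (meson card_image_le card_mono finite_imageI order_trans)
  then show ?thesis using card_edges(2)[OF assms(2)] by simp
qed

section \<open>Exchange arguments in a social optimum\<close>

text \<open>Only the first greedy step is required. Unlike greedy connectivity, this depends on the
  edges at \<open>u\<close> alone, so vertices can be repaired independently.\<close>

definition covers :: "'p::metric_space set \<Rightarrow> 'p set set \<Rightarrow> 'p \<Rightarrow> bool" where
  "covers P E u \<longleftrightarrow> (\<forall>w\<in>P - {u}. \<exists>v. {u, v} \<in> E \<and> dist v w < dist u w)"

lemma covers_mono: "covers P E u \<Longrightarrow> E \<subseteq> E' \<Longrightarrow> covers P E' u"
  unfolding covers_def by blast

lemma greedy_connected_covers:
  assumes "greedy_connected P E u"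
  shows "covers P E u"
  unfolding covers_def
proof
  fix w assume w: "w \<in> P - {u}"
  then obtain xs where xs: "greedy_path E xs u w" using assms unfolding greedy_connected_def by blast
  then obtain y ys where "xs = u # y # ys"
    using w unfolding greedy_path_def by (cases xs; cases "tl xs") auto
  then show "\<exists>v. {u, v} \<in> E \<and> dist v w < dist u w"
    using xs unfolding greedy_path_def by (intro exI[of _ y]) force
qed

lemma edge_set_on_possible_edges:
  assumes "edge_set_on P E" "e \<in> E" "u \<in> e"
  shows "e \<in> possible_edges P u" "u \<in> P"
proof -
  obtain a b where "a \<in> P" "b \<in> P" "a \<noteq> b" "e = {a, b}"
    using assms unfolding edge_set_on_def by blast
  then show "e \<in> possible_edges P u" "u \<in> P"
    using assms(3) unfolding possible_edges_def by (auto simp: insert_commute)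
qed

lemma greedy_path_Cons:
  assumes "greedy_path E xs v w" "{u, v} \<in> E" "dist v w < dist u w"
  shows "greedy_path E (u # xs) u w"
proof -
  have xs: "xs \<noteq> []" "xs ! 0 = v" "last xs = w"
    and step: "\<And>i. Suc i < length xs \<Longrightarrow> {xs ! i, xs ! Suc i} \<in> E \<and> dist (xs ! i) w > dist (xs ! Suc i) w"
    using assms(1) unfolding greedy_path_def by (auto simp: hd_conv_nth)
  have "{(u # xs) ! i, (u # xs) ! Suc i} \<in> E \<and> dist ((u # xs) ! i) w > dist ((u # xs) ! Suc i) w"
    if "Suc i < length (u # xs)" for i
    using assms(2,3) xs(2) step[of "i - 1"] that by (cases i) auto
  then show ?thesis using xs unfolding greedy_path_def by simp
qed

text \<open>Moving to closer neighbours terminates because the number of points closer to the target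
  drops. Every vertex on the way must have such a step, hence the assumption on all of
  \<open>P\<close>.\<close>

lemma covers_greedy_connected:
  assumes fin: "finite P" and E: "edge_set_on P E" and cov: "\<forall>u\<in>P. covers P E u" and "u \<in> P"
  shows "greedy_connected P E u"
proof -
  have "\<exists>xs. greedy_path E xs u w" if "w \<in> P" "u \<in> P" for u w
    using that(2)
  proof (induction "card {x \<in> P. dist x w < dist u w}" arbitrary: u rule: less_induct)
    case less
    show ?case
    proof (cases "u = w")
      case True
      then show ?thesis by (intro exI[of _ "[u]"]) (simp add: greedy_path_def)
    next
      case False
      then have "w \<in> P - {u}" using that(1) by simp
      moreover have "covers P E u" using cov less.prems by simp
      ultimately obtain v where v: "{u, v} \<in> E" "dist v w < dist u w"
        unfolding covers_def by blast
      have "v \<in> P" using edge_set_on_possible_edges(2)[OF E v(1)] by simp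
      moreover have "card {x \<in> P. dist x w < dist v w} < card {x \<in> P. dist x w < dist u w}"
        using fin v(2) \<open>v \<in> P\<close> by (intro psubset_card_mono) auto
      ultimately obtain xs where "greedy_path E xs v w" using less.hyps by blast
      then show ?thesis using greedy_path_Cons v by blast
    qed
  qed
  then show ?thesis using assms(4) unfolding greedy_connected_def by auto
qed

text \<open>Asking only for \<open>covers\<close> makes this a lower bound on the cost of a
  deviation, which must achieve greedy connectivity.\<close>

definition best_response :: "'p::metric_space set \<Rightarrow> 'p set set \<Rightarrow> 'p \<Rightarrow> 'p set set \<Rightarrow> nat" where
  "best_response P E u D = (LEAST n. \<exists>S. S \<subseteq> possible_edges P u \<and> card S = n \<and> covers P ((E - D) \<union> S) u)"

lemma best_response_le:
  assumes "S \<subseteq> possible_edges P u" "covers P ((E - D) \<union> S) u"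
  shows "best_response P E u D \<le> card S"
  unfolding best_response_def by (rule Least_le, intro exI[of _ S] conjI refl assms)

lemma finite_possible_edges:
  assumes "finite P"
  shows "finite (possible_edges P u)"
proof -
  have "possible_edges P u = (\<lambda>v. {u, v}) ` (P - {u})" unfolding possible_edges_def by blast
  then show ?thesis using assms by simp
qed

lemma edge_set_on_subset: "edge_set_on P E \<Longrightarrow> E' \<subseteq> E \<Longrightarrow> edge_set_on P E'"
  unfolding edge_set_on_def by (rule ballI, drule (1) subsetD) simp

lemma edge_set_on_Un: "edge_set_on P E \<Longrightarrow> edge_set_on P E' \<Longrightarrow> edge_set_on P (E \<union> E')"
  unfolding edge_set_on_def by (simp add: ball_Un)

lemma possible_edges_edge_set:
  assumes "u \<in> P" "S \<subseteq> possible_edges P u"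
  shows "edge_set_on P S"
  unfolding edge_set_on_def
proof
  fix e assume "e \<in> S"
  then obtain v where "e = {u, v}" "v \<in> P" "v \<noteq> u"
    using assms(2) unfolding possible_edges_def by blast
  then show "\<exists>a b. a \<in> P \<and> b \<in> P \<and> a \<noteq> b \<and> e = {a, b}" using assms(1) by blast
qed

lemma edge_set_on_finite:
  assumes "finite P" "edge_set_on P E"
  shows "finite E"
proof (rule finite_subset)
  show "E \<subseteq> Pow P" using edge_set_on_possible_edges(2)[OF assms(2)] by blast
qed (simp add: assms(1))

locale optimum =
  fixes P :: "(real^2) set" and E :: "(real^2) set set"
  assumes fin: "finite P" and opt: "social_optimum P E"
begin

lemma E_edges: "edge_set_on P E"
  using opt unfolding social_optimum_def by simp

lemma E_covers: "u \<in> P \<Longrightarrow> covers P E u"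
  using opt greedy_connected_covers unfolding social_optimum_def by blast

lemma E_minimal: "edge_set_on P E' \<Longrightarrow> (\<And>u. u \<in> P \<Longrightarrow> covers P E' u) \<Longrightarrow> card E \<le> card E'"
  using opt covers_greedy_connected[OF fin] unfolding social_optimum_def by blast

lemma fin_E: "finite E"
  using edge_set_on_finite[OF fin E_edges] .

text \<open>The common form of both uses of minimality, the sparsity bound and the exchange
  inequality.\<close>

lemma replace_le:
  assumes "D \<subseteq> E" "finite G" "edge_set_on P G" "\<And>u. u \<in> P \<Longrightarrow> covers P ((E - D) \<union> G) u"
  shows "card D \<le> card G"
proof -
  have "card E \<le> card ((E - D) \<union> G)"
    using assms edge_set_on_subset[OF E_edges, of "E - D"] by (intro E_minimal edge_set_on_Un) auto
  also have "\<dots> \<le> card (E - D) + card G" by (rule card_Un_le)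
  also have "card (E - D) = card E - card D"
    using assms(1) fin_E by (intro card_Diff_subset finite_subset[OF assms(1)])
  finally show ?thesis using card_mono[OF fin_E assms(1)] by simp
qed

text \<open>A greedy step along an edge inside \<open>V\<close> is replaced by a Delaunay step
  towards the same target; all other edges stay.\<close>

lemma induced_sparse:
  assumes "V \<subseteq> P" "V \<noteq> {}"
  shows "card {e \<in> E. e \<subseteq> V} < 3 * card V"
proof -
  have finV: "finite V" using fin assms(1) finite_subset by blast
  have del: "edge_set_on P (delaunay V)"
    using assms(1) unfolding edge_set_on_def delaunay_def by blast
  have "card {e \<in> E. e \<subseteq> V} \<le> card (delaunay V)"
  proof (rule replace_le)
    fix u assume u: "u \<in> P"
    show "covers P ((E - {e \<in> E. e \<subseteq> V}) \<union> delaunay V) u"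
      unfolding covers_def
    proof
      fix w assume "w \<in> P - {u}"
      then obtain v where v: "{u, v} \<in> E" "dist v w < dist u w"
        using E_covers[OF u] unfolding covers_def by blast
      show "\<exists>v. {u, v} \<in> (E - {e \<in> E. e \<subseteq> V}) \<union> delaunay V \<and> dist v w < dist u w"
      proof (cases "{u, v} \<subseteq> V")
        case True
        then show ?thesis using delaunay_greedy_step[OF finV, of u v w] v(2) by auto
      next
        case False
        then show ?thesis using v by blast
      qed
    qed
  qed (use del edge_set_on_finite[OF fin] in auto)
  also have "\<dots> < 3 * card V" using card_delaunay[OF finV assms(2)] .
  finally show ?thesis .
qed

text \<open>Buying \<open>D\<close> back is a feasible repair, so the \<open>LEAST\<close> in
  \<open>best_response\<close> is attained.\<close>

lemma best_response_witness:
  assumes "u \<in> P" "D \<subseteq> {e \<in> E. u \<in> e}"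
  obtains S where "S \<subseteq> possible_edges P u" "card S = best_response P E u D" "covers P ((E - D) \<union> S) u"
proof -
  have "D \<subseteq> possible_edges P u" using assms(2) edge_set_on_possible_edges[OF E_edges] by blast
  moreover have "covers P ((E - D) \<union> D) u" using E_covers[OF assms(1)] by (rule covers_mono) auto
  ultimately have "\<exists>n S. S \<subseteq> possible_edges P u \<and> card S = n \<and> covers P ((E - D) \<union> S) u" by blast
  then have "\<exists>S. S \<subseteq> possible_edges P u \<and> card S = best_response P E u D \<and> covers P ((E - D) \<union> S) u"
    unfolding best_response_def by (rule LeastI_ex)
  then show ?thesis using that by blast
qed

sublocale exchange_graph P E "best_response P E"
proof
  show "finite P" "edge_set_on P E" using fin E_edges by auto
  show "card {e \<in> E. e \<subseteq> V} < 3 * card V" if "V \<subseteq> P" "V \<noteq> {}" for V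
    using induced_sparse that .
  show "best_response P E v {} = 0" if "v \<in> P" for v
    using best_response_le[of "{}" P v E "{}"] E_covers[OF that] by simp
  show "best_response P E v (insert e D) \<le> best_response P E v D + 1"
    if v: "v \<in> P" "D \<subseteq> {e \<in> E. v \<in> e}" "e \<in> E" "v \<in> e" for v D e
  proof -
    obtain S where S: "S \<subseteq> possible_edges P v" "card S = best_response P E v D" "covers P ((E - D) \<union> S) v"
      using best_response_witness[OF v(1,2)] .
    have "covers P ((E - insert e D) \<union> insert e S) v" using S(3) by (rule covers_mono) auto
    then have "best_response P E v (insert e D) \<le> card (insert e S)"
      using S(1) edge_set_on_possible_edges(1)[OF E_edges v(3,4)] by (intro best_response_le) auto
    also have "\<dots> \<le> card S + 1"
      using finite_subset[OF S(1) finite_possible_edges[OF fin]] by (simp add: card_insert_if)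
    finally show ?thesis using S(2) by simp
  qed
  show "best_response P E v C \<le> best_response P E v D"
    if v: "v \<in> P" "C \<subseteq> D" "D \<subseteq> {e \<in> E. v \<in> e}" for v C D
  proof -
    obtain S where S: "S \<subseteq> possible_edges P v" "card S = best_response P E v D" "covers P ((E - D) \<union> S) v"
      using best_response_witness[OF v(1,3)] .
    have "covers P ((E - C) \<union> S) v" using S(3) by (rule covers_mono) (use v(2) in auto)
    then show ?thesis using best_response_le S(1,2) by metis
  qed
  show "card D \<le> (\<Sum>v\<in>P. best_response P E v {e \<in> D. v \<in> e})" if D: "D \<subseteq> E" for D
  proof -
    have "\<forall>v\<in>P. \<exists>S. S \<subseteq> possible_edges P v \<and> card S = best_response P E v {e \<in> D. v \<in> e} \<and>
        covers P ((E - {e \<in> D. v \<in> e}) \<union> S) v"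
      using best_response_witness D by (metis (mono_tags, lifting) Collect_mono_iff subset_iff)
    from bchoice[OF this] obtain S where "\<forall>v\<in>P. S v \<subseteq> possible_edges P v \<and>
        card (S v) = best_response P E v {e \<in> D. v \<in> e} \<and> covers P ((E - {e \<in> D. v \<in> e}) \<union> S v) v" ..
    then have S: "S v \<subseteq> possible_edges P v" "card (S v) = best_response P E v {e \<in> D. v \<in> e}"
      "covers P ((E - {e \<in> D. v \<in> e}) \<union> S v) v" if "v \<in> P" for v using that by auto
    have G: "edge_set_on P (\<Union>v\<in>P. S v)"
      using possible_edges_edge_set[OF _ S(1)] unfolding edge_set_on_def by blast
    have "card D \<le> card (\<Union>v\<in>P. S v)"
    proof (rule replace_le[OF D])
      fix u assume u: "u \<in> P"
      show "covers P ((E - D) \<union> (\<Union>v\<in>P. S v)) u"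
        unfolding covers_def
      proof
        fix w assume "w \<in> P - {u}"
        then obtain v where v: "{u, v} \<in> (E - {e \<in> D. u \<in> e}) \<union> S u" "dist v w < dist u w"
          using S(3)[OF u] unfolding covers_def by blast
        \<comment> \<open>An edge at \<open>u\<close> that survives the removal of the part of
          \<open>D\<close> at \<open>u\<close> is not in \<open>D\<close> at all.\<close>
        then have "{u, v} \<in> (E - D) \<union> (\<Union>v\<in>P. S v)" using u by blast
        then show "\<exists>v. {u, v} \<in> (E - D) \<union> (\<Union>v\<in>P. S v) \<and> dist v w < dist u w" using v(2) by blast
      qed
    qed (use G edge_set_on_finite[OF fin] in auto)
    also have "\<dots> \<le> (\<Sum>v\<in>P. card (S v))" using fin by (rule card_UN_le)
    also have "\<dots> = (\<Sum>v\<in>P. best_response P E v {e \<in> D. v \<in> e})" using S(2) by simp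
    finally show ?thesis .
  qed
qed

end

section \<open>From the assignment to the equilibrium\<close>

theorem mainTheorem17:
  fixes P :: "(real^2) set" and E :: "(real^2) set set"
  assumes "finite P" and "social_optimum P E"
  shows "\<exists>own :: (real^2) set \<Rightarrow> real^2.
           (\<forall>e\<in>E. own e \<in> e) \<and>
           additive_NE P (\<lambda>u. {e\<in>E. own e = u}) 2"
proof -
  interpret optimum P E using assms by (rule optimum.intro)
  obtain own where own: "\<forall>e\<in>E. own e \<in> e"
    and two: "\<And>v. v \<in> P \<Longrightarrow> card (outs E own v) \<le> best_response P E v (outs E own v) + 2"
    using assignment_within_two by blast
  define s where "s = outs E own"
  have s_edges: "s u \<subseteq> {e \<in> E. u \<in> e}" for u using own unfolding s_def outs_def by auto
  then have s_possible: "s u \<subseteq> possible_edges P u" for u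
    using edge_set_on_possible_edges(1)[OF E_edges] by blast
  have net: "network P s = E"
    using own edge_set_on_possible_edges(2)[OF E_edges] unfolding network_def s_def outs_def by auto
  have "\<not> cost P (s(u := S)) u < cost P s u - ereal 2"
    if u: "u \<in> P" and S: "S \<subseteq> possible_edges P u" for u S
  proof
    assume less: "cost P (s(u := S)) u < cost P s u - ereal 2"
    have "greedy_connected P E u" using assms(2) u unfolding social_optimum_def by simp
    then have old: "cost P s u = ereal (real (card (s u)))" unfolding cost_def net by simp
    then have gc: "greedy_connected P (network P (s(u := S))) u"
      using less unfolding cost_def by (auto split: if_splits)
    then have "ereal (real (card S)) < ereal (real (card (s u)) - 2)"
      using less old unfolding cost_def by simp
    then have "card S + 2 < card (s u)" by simp
    moreover have "covers P ((E - s u) \<union> S) u"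
    proof (rule covers_mono[OF greedy_connected_covers[OF gc]])
      \<comment> \<open>Each edge has a single owner, so no other agent retains an edge of
        \<open>s u\<close>.\<close>
      show "network P (s(u := S)) \<subseteq> (E - s u) \<union> S"
        unfolding network_def s_def outs_def by auto
    qed
    then have "best_response P E u (s u) \<le> card S" using S by (rule best_response_le[rotated])
    ultimately show False using two[OF u] unfolding s_def by simp
  qed
  then have "additive_NE P s 2" using s_possible unfolding additive_NE_def valid_profile_def by blast
  moreover have "s = (\<lambda>u. {e \<in> E. own e = u})" unfolding s_def outs_def by auto
  ultimately show ?thesis using own by auto
qed

end
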